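(* Let $G$ be a finite abelian group and let $p$ be a prime satisfying $p \prec^2 \exp(G)$, i.e. $p \nmid \exp(G)$ and $$\frac{2p+2}{2p+1} > \sum_{d \mid \exp(G)} \frac{1}{d}.$$ Then for all positive integers $m,n$, $$\mathsf{k}(C_{p^m} \oplus C_{p^n} \oplus G) = \mathsf{k}(C_{p^m}) + \mathsf{k}(C_{p^n}) + \mathsf{k}(G).$$ In particular, if $\mathsf{k}(G) = \mathsf{k}^{\star}(G)$, then $\mathsf{k}(C_{p^m} \oplus C_{p^n} \oplus G) = \mathsf{k}^{\star}(C_{p^m} \oplus C_{p^n} \oplus G)$.
   Context: All groups are finite abelian, written additively; $C_n$ denotes the cyclic group of order $n$ and $\exp(G)$ the least common multiple of the orders of elements of $G$. A sequence over $G$ is a finite unordered sequence of elements of $G$ with repetition allowed (an element of the free abelian monoid on $G$); $v_g(S)$ is the multiplicity of $g$ in $S$, and a subsequence $T \mid S$ satisfies $v_g(T)\le v_g(S)$ for all $g$. The sum of $S$ is $\sigma(S)=\sum_g v_g(S) g$. $S$ is zero-sum free if no nonempty subsequence has sum $0$. The cross number of $S$ is $\mathsf{k}(S)=\sum_{g\in G} v_g(S)/\operatorname{ord}(g)$. The little cross number $\mathsf{k}(G)$ is the maximum of $\mathsf{k}(S)$ over zero-sum free sequences $S$ over $G$. If $G \cong \bigoplus_{i=1}^{r} C_{p_i^{\alpha_i}}$ with prime powers $p_i^{\alpha_i}$, then $\mathsf{k}^\star(G)=\sum_{i=1}^r (1-1/p_i^{\alpha_i})$. *)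

theory Defs
  imports Complex_Main "HOL-Library.Multiset" "HOL-Computational_Algebra.Primes"
    "HOL-Algebra.Multiplicative_Group" "HOL-Algebra.Product_Groups"
begin

text \<open>Groups are in the multiplicative notation of HOL-Algebra, so a sum over the group is
  written as \<^term>\<open>finprod\<close>, and zero is \<^term>\<open>one\<close>. A sequence over \<open>G\<close> is a multiset of
  elements of the carrier. All notions below are meant for finite abelian groups.\<close>

definition group_exp :: "('a, 'b) monoid_scheme \<Rightarrow> nat" where
  "group_exp G = Lcm (group.ord G ` carrier G)"

definition seq_over :: "('a, 'b) monoid_scheme \<Rightarrow> 'a multiset \<Rightarrow> bool" where
  "seq_over G S \<longleftrightarrow> set_mset S \<subseteq> carrier G"

definition seq_sum :: "('a, 'b) monoid_scheme \<Rightarrow> 'a multiset \<Rightarrow> 'a" where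
  "seq_sum G S = finprod G (\<lambda>g. g [^]\<^bsub>G\<^esub> count S g) (carrier G)"

definition zero_sum_free :: "('a, 'b) monoid_scheme \<Rightarrow> 'a multiset \<Rightarrow> bool" where
  "zero_sum_free G S \<longleftrightarrow> (\<forall>T. T \<subseteq># S \<and> T \<noteq> {#} \<longrightarrow> seq_sum G T \<noteq> \<one>\<^bsub>G\<^esub>)"

definition cross_number :: "('a, 'b) monoid_scheme \<Rightarrow> 'a multiset \<Rightarrow> real" where
  "cross_number G S = (\<Sum>g\<in>carrier G. real (count S g) / real (group.ord G g))"

text \<open>For finite \<open>G\<close> the maximum is over a finite set, since \<open>g\<close> occurs fewer than \<open>ord g\<close> times
  in a zero-sum free sequence; the set is nonempty, since the empty sequence is zero-sum free.\<close>

definition little_cross :: "('a, 'b) monoid_scheme \<Rightarrow> real" where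
  "little_cross G = Max {cross_number G S | S. seq_over G S \<and> zero_sum_free G S}"

text \<open>The value is well defined because the prime powers in a decomposition of \<open>G\<close> into cyclic
  groups of prime power order exist and are unique up to order. The trivial group has \<open>r = 0\<close>.\<close>

definition k_star :: "('a, 'b) monoid_scheme \<Rightarrow> real" where
  "k_star G = (THE x. \<exists>(r::nat) (p :: nat \<Rightarrow> nat) (a :: nat \<Rightarrow> nat).
      (\<forall>i<r. prime (p i) \<and> a i \<ge> 1) \<and>
      G \<cong> product_group {..<r} (\<lambda>i. integer_mod_group (p i ^ a i)) \<and>
      x = (\<Sum>i<r. 1 - 1 / real (p i ^ a i)))"

definition prec2 :: "nat \<Rightarrow> nat \<Rightarrow> bool" where
  "prec2 p n \<longleftrightarrow> \<not> p dvd n \<and>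
     (2 * real p + 2) / (2 * real p + 1) > (\<Sum>d | d dvd n. 1 / real d)"

end

theory Submission
  imports Defs "HOL-Number_Theory.Cong"
begin

text \<open>Let \<open>H = C_{p^m} \<oplus> C_{p^n}\<close>, \<open>W = k\<^sup>*(H)\<close>, and let \<open>\<epsilon>\<close> be the sum of \<open>1/d\<close> over the
  divisors \<open>d > 1\<close> of \<open>exp(G)\<close>, so that \<open>\<epsilon> < 1/(2p+1)\<close>. Olson's group algebra argument, run with the
  weights \<open>1/ord(g)\<close>, bounds the cross number of zero-sum free sequences over \<open>H\<close> by \<open>W\<close>.

  Take a zero-sum free sequence over \<open>H \<oplus> G\<close> of maximal cross number and, among those, of minimal
  length. No subsequence can be replaced by its sum without loss, and any \<open>3p - 2\<close> elements of
  \<open>C_p \<oplus> C_p\<close> have a zero-sum subsequence of length at most \<open>p\<close>; hence fewer than \<open>3p - 2\<close> terms have any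
  given order \<open>p^i d\<close> with \<open>i \<ge> 1\<close>. Let \<open>P\<close> be the part of the sequence in \<open>H\<close> and \<open>N\<close> the rest. If the
  subsums of \<open>P\<close> contain a subgroup \<open>L\<close> of \<open>H\<close>, then the terms of \<open>N\<close> in \<open>L \<oplus> G\<close> project to a zero-sum
  free sequence over \<open>G\<close>. Choose an element of \<open>H\<close> of minimal order \<open>p^(j+1)\<close> that is not a subsum of
  \<open>P\<close>; appending its inverse to \<open>P\<close> shows \<open>k(P) \<le> W - 1/p^(j+1)\<close>.

  If even \<open>k(P) \<le> W - 2/p^(j+1)\<close>, take \<open>L = H[p^j]\<close>; the terms of \<open>N\<close> of higher level weigh at most
  \<open>3\<epsilon>/p^j \<le> 2/p^(j+1)\<close>. Otherwise second differences vanish on \<open>H[p^(j+1)]\<close>, so the function detecting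
  whether an element is a subsum is additive there modulo \<open>p\<close>, and its kernel \<open>L\<close> consists of subsums
  and has index \<open>p\<close>. The terms of \<open>N\<close> of level \<open>j + 1\<close> outside \<open>L\<close> can be amalgamated until fewer than
  \<open>p\<close> are left for every \<open>d\<close>, and the total excess is at most \<open>\<epsilon>(p + 2)/p^(j+1) \<le> 1/p^(j+1)\<close>.\<close>

section \<open>Sequences over finite abelian groups\<close>

lemma subset_mset_image_msetE:
  assumes "T \<subseteq># image_mset f S"
  obtains S' where "S' \<subseteq># S" "T = image_mset f S'"
proof -
  obtain U where "image_mset f S = T + U" using assms by (metis subset_mset.less_eqE)
  then obtain B C where "S = B + C" "T = image_mset f B"
    by (metis image_mset_eq_plusD)
  then show ?thesis using that[of B] by simp
qed

lemma subset_mset_add_msetI: "T \<subseteq># S \<Longrightarrow> T \<subseteq># add_mset x S"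
  by (metis add_mset_add_single mset_subset_eq_add_left subset_mset.order_trans)

lemma subset_mset_add_msetE:
  assumes "T \<subseteq># add_mset x S"
  obtains "T \<subseteq># S" | T' where "T = add_mset x T'" "T' \<subseteq># S"
proof (cases "x \<in># T")
  case True
  then obtain T' where "T = add_mset x T'" by (metis insert_DiffM)
  then show ?thesis using assms that(2) by auto
next
  case False
  have "T \<subseteq># S"
  proof (rule mset_subset_eqI)
    fix y
    show "count T y \<le> count S y"
      using mset_subset_eq_count[OF assms, of y] False by (cases "y = x") (auto simp: not_in_iff)
  qed
  then show ?thesis using that(1) by blast
qed

lemma subset_mset_of_size:
  assumes "n \<le> size S"
  obtains T where "T \<subseteq># S" "size T = n"
  using assms
proof (induction S arbitrary: thesis)
  case empty
  then show ?case by auto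
next
  case (add x S)
  show ?case
  proof (cases "n \<le> size S")
    case True
    then show ?thesis using add by (metis subset_mset.order_trans mset_subset_eq_add_right add_mset_add_single union_commute)
  next
    case False
    then have "n = size (add_mset x S)" using add.prems by auto
    then show ?thesis using add.prems(1) by blast
  qed
qed

lemma finite_submultisets: "finite {T. T \<subseteq># S}"
proof (induction S)
  case empty
  then show ?case by auto
next
  case (add x S)
  have "{T. T \<subseteq># add_mset x S} \<subseteq> {T. T \<subseteq># S} \<union> add_mset x ` {T. T \<subseteq># S}"
    by (auto elim: subset_mset_add_msetE)
  then show ?case using add by (meson finite_UnI finite_imageI finite_subset)
qed

text \<open>Grouping the terms by key, each class contributes at most \<open>c\<close> times its
  weight. With the order of a term as key, a bound on the number of terms of each order becomes a
  bound on the cross number.\<close>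

lemma sum_mset_key_le:
  fixes w :: "'k \<Rightarrow> real"
  assumes "finite A" "\<And>z. z \<in># R \<Longrightarrow> key z \<in> A" "\<And>k. k \<in> A \<Longrightarrow> w k \<ge> 0"
    and "\<And>k. k \<in> A \<Longrightarrow> real (size {#z \<in># R. key z = k#}) \<le> c"
  shows "(\<Sum>z\<in>#R. w (key z)) \<le> (\<Sum>k\<in>A. c * w k)"
proof -
  have "(\<Sum>z\<in>#R. w (key z)) = (\<Sum>k\<in>A. real (size {#z \<in># R. key z = k#}) * w k)"
    using assms(2)
  proof (induction R)
    case (add x R)
    have "(\<Sum>k\<in>A. real (size {#z \<in># add_mset x R. key z = k#}) * w k)
       = (\<Sum>k\<in>A. (if key x = k then w k else 0) + real (size {#z \<in># R. key z = k#}) * w k)"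
      by (intro sum.cong) (auto simp: algebra_simps)
    also have "\<dots> = w (key x) + (\<Sum>k\<in>A. real (size {#z \<in># R. key z = k#}) * w k)"
      using add.prems assms(1) by (simp add: sum.distrib)
    finally show ?case using add by simp
  qed auto
  also have "\<dots> \<le> (\<Sum>k\<in>A. c * w k)"
    using assms by (intro sum_mono mult_right_mono) auto
  finally show ?thesis .
qed

lemma sum_mset_mono_real:
  fixes f g :: "'a \<Rightarrow> real"
  assumes "\<And>z. z \<in># R \<Longrightarrow> f z \<le> g z"
  shows "(\<Sum>z\<in>#R. f z) \<le> (\<Sum>z\<in>#R. g z)"
  using assms by (induction R) (auto intro: add_mono)

section \<open>Sums, cross numbers and zero-sum free sequences in one group\<close>

locale fin_comm_group = comm_group +
  assumes fin: "finite (carrier G)"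
begin

lemma ord_pos: "x \<in> carrier G \<Longrightarrow> ord x > 0"
  using ord_ge_1[OF fin] by fastforce

lemma seq_sum_empty [simp]: "seq_sum G {#} = \<one>"
  by (simp add: seq_sum_def)

lemma seq_sum_closed [simp]:
  assumes "set_mset S \<subseteq> carrier G" shows "seq_sum G S \<in> carrier G"
  unfolding seq_sum_def by (rule finprod_closed) auto

lemma seq_sum_add_mset [simp]:
  assumes "x \<in> carrier G" "set_mset S \<subseteq> carrier G"
  shows "seq_sum G (add_mset x S) = x \<otimes> seq_sum G S"
proof -
  have "seq_sum G (add_mset x S)
     = finprod G (\<lambda>g. (if g = x then g else \<one>) \<otimes> g [^] count S g) (carrier G)"
    unfolding seq_sum_def
    by (rule finprod_cong') (auto simp: m_comm)
  also have "\<dots> = finprod G (\<lambda>g. if g = x then g else \<one>) (carrier G) \<otimes> seq_sum G S"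
    unfolding seq_sum_def by (rule finprod_multf) auto
  also have "finprod G (\<lambda>g. if g = x then g else \<one>) (carrier G) = x"
    using finprod_singleton_swap[OF assms(1) fin, of "\<lambda>g. g"] by (simp add: Pi_def)
  finally show ?thesis .
qed

lemma seq_sum_union [simp]:
  assumes "set_mset S \<subseteq> carrier G" "set_mset T \<subseteq> carrier G"
  shows "seq_sum G (S + T) = seq_sum G S \<otimes> seq_sum G T"
  using assms by (induction S) (auto simp: m_assoc)

lemma cross_number_eq:
  assumes "set_mset S \<subseteq> carrier G"
  shows "cross_number G S = (\<Sum>g\<in>#S. 1 / real (ord g))"
  using assms
proof (induction S)
  case empty
  then show ?case by (simp add: cross_number_def)
next
  case (add x S)
  have "cross_number G (add_mset x S)
    = (\<Sum>g\<in>carrier G. (if g = x then 1 / real (ord g) else 0) + real (count S g) / real (ord g))"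
    unfolding cross_number_def by (intro sum.cong) (auto simp: field_simps add_divide_distrib)
  also have "\<dots> = 1 / real (ord x) + cross_number G S"
    using add.prems fin by (simp add: sum.distrib cross_number_def)
  finally show ?case using add by simp
qed

lemma seq_over_subset: "set_mset S \<subseteq> carrier G \<Longrightarrow> T \<subseteq># S \<Longrightarrow> set_mset T \<subseteq> carrier G"
  by (meson set_mset_mono subset_trans)

lemma seq_sum_replicate:
  assumes "x \<in> carrier G" shows "seq_sum G (replicate_mset n x) = x [^] n"
  using assms by (induction n) (auto simp: m_comm)

lemma zero_sum_free_count:
  assumes "set_mset S \<subseteq> carrier G" "zero_sum_free G S" "x \<in> carrier G"
  shows "count S x < ord x"
proof (rule ccontr)
  assume "\<not> ?thesis"
  then have "replicate_mset (ord x) x \<subseteq># S" by (simp add: count_le_replicate_mset_subset_eq[symmetric])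
  moreover have "replicate_mset (ord x) x \<noteq> {#}" using ord_pos[OF assms(3)] by auto
  moreover have "seq_sum G (replicate_mset (ord x) x) = \<one>"
    using assms(3) by (simp add: seq_sum_replicate)
  ultimately show False using assms(2) unfolding zero_sum_free_def by blast
qed

text \<open>All zero-sum free sequences lie below one multiset, in which every \<open>x\<close>
  occurs \<open>ord x\<close> times. Hence the maximum in \<open>little_cross\<close> ranges over a
  finite set and is attained.\<close>

lemma finite_zero_sum_free: "finite {S. seq_over G S \<and> zero_sum_free G S}"
proof -
  define M where "M = (\<Sum>x\<in>carrier G. replicate_mset (ord x) x)"
  have cM: "count M x = ord x" if "x \<in> carrier G" for x
    using that fin by (simp add: M_def count_sum)
  have "S \<subseteq># M" if "seq_over G S" "zero_sum_free G S" for S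
  proof (rule mset_subset_eqI)
    fix x
    show "count S x \<le> count M x"
    proof (cases "x \<in> carrier G")
      case True
      then show ?thesis using zero_sum_free_count[of S x] that cM[OF True]
        by (simp add: seq_over_def)
    next
      case False
      then have "count S x = 0" using that(1) by (auto simp: seq_over_def not_in_iff)
      then show ?thesis by simp
    qed
  qed
  then show ?thesis by (intro finite_subset[OF _ finite_submultisets[of M]]) auto
qed

lemma finite_cross_numbers: "finite {cross_number G S | S. seq_over G S \<and> zero_sum_free G S}"
  using finite_zero_sum_free by simp

lemma zero_sum_free_empty: "zero_sum_free G {#}"
  by (simp add: zero_sum_free_def)

lemma cross_number_le_little_cross:
  assumes "set_mset S \<subseteq> carrier G" "zero_sum_free G S"
  shows "cross_number G S \<le> little_cross G"
  unfolding little_cross_def using assms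
  by (intro Max_ge finite_cross_numbers) (auto simp: seq_over_def)

lemma little_cross_attained:
  obtains S where "set_mset S \<subseteq> carrier G" "zero_sum_free G S" "cross_number G S = little_cross G"
proof -
  have "little_cross G \<in> {cross_number G S | S. seq_over G S \<and> zero_sum_free G S}"
    unfolding little_cross_def
    using zero_sum_free_empty by (intro Max_in finite_cross_numbers) (force simp: seq_over_def)
  then show ?thesis using that by (auto simp: seq_over_def)
qed

lemma ord_seq_sum_dvd:
  assumes "set_mset S \<subseteq> carrier G" "\<And>x. x \<in># S \<Longrightarrow> x [^] (n::nat) = \<one>"
  shows "seq_sum G S [^] n = \<one>"
  using assms by (induction S) (auto simp: pow_mult_distrib m_comm)

end

section \<open>Homomorphisms and direct products\<close>

lemma seq_sum_hom:
  assumes "fin_comm_group A" "fin_comm_group B" "h \<in> hom A B" "set_mset S \<subseteq> carrier A"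
  shows "h (seq_sum A S) = seq_sum B (image_mset h S)"
proof -
  interpret A: fin_comm_group A by fact
  interpret B: fin_comm_group B by fact
  interpret group_hom A B h using assms(3) by unfold_locales
  have hc: "h ` set_mset S \<subseteq> carrier B" if "set_mset S \<subseteq> carrier A" for S
    using that by auto
  show ?thesis using assms(4)
    by (induction S) (use hc in \<open>auto simp: image_subset_iff\<close>)
qed

lemma fin_comm_group_DirProd:
  assumes "fin_comm_group A" "fin_comm_group B"
  shows "fin_comm_group (A \<times>\<times> B)"
proof -
  interpret A: fin_comm_group A by fact
  interpret B: fin_comm_group B by fact
  interpret P: group "A \<times>\<times> B" by (rule DirProd_group) unfold_locales
  show ?thesis
    by unfold_locales (auto simp: A.m_comm B.m_comm A.fin B.fin)
qed

lemma fin_comm_group_integer_mod_group: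
  "n > 0 \<Longrightarrow> fin_comm_group (integer_mod_group n)"
  by (simp add: fin_comm_group_def fin_comm_group_axioms_def carrier_integer_mod_group)

lemma DirProd_nat_pow:
  "(x, y) [^]\<^bsub>A \<times>\<times> B\<^esub> (n::nat) = (x [^]\<^bsub>A\<^esub> n, y [^]\<^bsub>B\<^esub> n)"
  by (induction n) auto

lemma ord_DirProd:
  assumes "group A" "group B" "x \<in> carrier A" "y \<in> carrier B"
  shows "group.ord (A \<times>\<times> B) (x, y) = lcm (group.ord A x) (group.ord B y)"
proof -
  interpret A: group A by fact
  interpret B: group B by fact
  interpret P: group "A \<times>\<times> B" by (rule DirProd_group) unfold_locales
  show ?thesis
    by (rule P.ord_unique[THEN iffD2])
      (use assms in \<open>auto simp: DirProd_nat_pow A.pow_eq_id B.pow_eq_id\<close>)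
qed

lemma hom_fst: "fst \<in> hom (A \<times>\<times> B) A"
  and hom_snd: "snd \<in> hom (A \<times>\<times> B) B"
  by (auto simp: hom_def)

lemma seq_sum_DirProd:
  assumes "fin_comm_group A" "fin_comm_group B" "set_mset S \<subseteq> carrier A \<times> carrier B"
  shows "seq_sum (A \<times>\<times> B) S = (seq_sum A (image_mset fst S), seq_sum B (image_mset snd S))"
  using seq_sum_hom[OF fin_comm_group_DirProd[OF assms(1,2)] assms(1) hom_fst, of S]
    seq_sum_hom[OF fin_comm_group_DirProd[OF assms(1,2)] assms(2) hom_snd, of S] assms(3)
  by (simp add: prod_eq_iff)

section \<open>Difference operators and the cross number of p-groups\<close>

text \<open>Dual form of Olson's method: applying \<open>diff_op\<close> to \<open>f\<close> pairs \<open>f\<close> with the product of the elements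
  \<open>1 - g\<close> of the group algebra. An Olson function is a delta function at the identity modulo \<open>p\<close> that
  is annihilated by all sequences of cross number greater than \<open>W\<close>.\<close>

fun diff_op :: "('a, 'b) monoid_scheme \<Rightarrow> ('a \<Rightarrow> int) \<Rightarrow> 'a list \<Rightarrow> 'a \<Rightarrow> int" where
  "diff_op G f [] x = f x"
| "diff_op G f (g # P) x = diff_op G f P x - diff_op G f P (x \<otimes>\<^bsub>G\<^esub> g)"

definition olson_fun :: "nat \<Rightarrow> ('a, 'b) monoid_scheme \<Rightarrow> real \<Rightarrow> ('a \<Rightarrow> int) \<Rightarrow> bool" where
  "olson_fun p G W f \<longleftrightarrow> f \<one>\<^bsub>G\<^esub> = 1 \<and> (\<forall>x\<in>carrier G. x \<noteq> \<one>\<^bsub>G\<^esub> \<longrightarrow> int p dvd f x) \<and>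
     (\<forall>P. \<forall>x\<in>carrier G. set P \<subseteq> carrier G \<longrightarrow> (\<Sum>g\<leftarrow>P. 1 / real (group.ord G g)) > W \<longrightarrow>
        int p dvd diff_op G f P x)"

text \<open>Difference operators commute with translations in an abelian group, so \<open>f\<close>
  may be differenced by \<open>u\<close> before or after the list is applied.\<close>

lemma (in comm_group) diff_op_shift:
  assumes "x \<in> carrier G" "u \<in> carrier G" "set P \<subseteq> carrier G"
    and "\<And>y. y \<in> carrier G \<Longrightarrow> F y = f y - f (y \<otimes> u)"
  shows "diff_op G F P x = diff_op G f P x - diff_op G f P (x \<otimes> u)"
  using assms
proof (induction P arbitrary: x)
  case (Cons g P)
  have "x \<otimes> u \<otimes> g = x \<otimes> g \<otimes> u" using Cons.prems by (simp add: m_ac)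
  then show ?case using Cons by simp
qed simp

text \<open>In the group algebra 1 - (a, b) = (1 - a) + a (1 - b), so each term of \<open>P\<close>
  can be traded for its component \<open>a\<close> added to \<open>Q\<close> or its component
  \<open>b\<close> added to \<open>R\<close>. Component orders divide the order of the pair, so the
  total weight never drops. Once \<open>P\<close> is empty, \<open>Q\<close> weighs more than
  \<open>V\<close> or \<open>R\<close> more than \<open>W\<close>.\<close>

lemma olson_fun_DirProd_aux:
  fixes p :: nat
  assumes "fin_comm_group A" "fin_comm_group B"
    and f: "olson_fun p A V f" and h: "olson_fun p B W h"
    and "set P \<subseteq> carrier (A \<times>\<times> B)" "set Q \<subseteq> carrier A" "set R \<subseteq> carrier B"
    and "z \<in> carrier (A \<times>\<times> B)"
    and "(\<Sum>g\<leftarrow>P. 1 / real (group.ord (A \<times>\<times> B) g)) + (\<Sum>g\<leftarrow>Q. 1 / real (group.ord A g))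
          + (\<Sum>g\<leftarrow>R. 1 / real (group.ord B g)) > V + W"
  shows "int p dvd diff_op (A \<times>\<times> B) (\<lambda>z. diff_op A f Q (fst z) * diff_op B h R (snd z)) P z"
  using assms(5-)
proof (induction P arbitrary: Q R z)
  case Nil
  then have "(\<Sum>g\<leftarrow>Q. 1 / real (group.ord A g)) > V \<or> (\<Sum>g\<leftarrow>R. 1 / real (group.ord B g)) > W"
    by auto
  then have "int p dvd diff_op A f Q (fst z) \<or> int p dvd diff_op B h R (snd z)"
    using Nil f h unfolding olson_fun_def by (auto simp: mem_Times_iff)
  then show ?case by auto
next
  case (Cons g P)
  interpret A: fin_comm_group A by fact
  interpret B: fin_comm_group B by fact
  interpret AB: fin_comm_group "A \<times>\<times> B" by (rule fin_comm_group_DirProd) fact+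
  obtain a b where g: "g = (a, b)" by (cases g)
  obtain x y where z: "z = (x, y)" by (cases z)
  have car: "a \<in> carrier A" "b \<in> carrier B" "x \<in> carrier A" "y \<in> carrier B"
    "set P \<subseteq> carrier (A \<times>\<times> B)" "set P \<subseteq> carrier A \<times> carrier B"
    using Cons.prems g z by auto
  have ord: "group.ord (A \<times>\<times> B) g = lcm (A.ord a) (B.ord b)"
    using car unfolding g by (intro ord_DirProd) unfold_locales
  have "A.ord a \<le> group.ord (A \<times>\<times> B) g" "B.ord b \<le> group.ord (A \<times>\<times> B) g"
    unfolding ord using A.ord_pos[OF car(1)] B.ord_pos[OF car(2)]
    by (auto intro!: dvd_imp_le simp: lcm_pos_nat)
  then have wa: "1 / real (A.ord a) \<ge> 1 / real (group.ord (A \<times>\<times> B) g)"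
    and wb: "1 / real (B.ord b) \<ge> 1 / real (group.ord (A \<times>\<times> B) g)"
    using A.ord_pos[OF car(1)] B.ord_pos[OF car(2)]
    by (auto intro!: divide_left_mono mult_pos_pos)
  let ?F = "\<lambda>Q R z. diff_op A f Q (fst z) * diff_op B h R (snd z)"
  have "diff_op (A \<times>\<times> B) (?F Q R) (g # P) z
    = (diff_op (A \<times>\<times> B) (?F Q R) P (x, y) - diff_op (A \<times>\<times> B) (?F Q R) P ((x, y) \<otimes>\<^bsub>A \<times>\<times> B\<^esub> (a, \<one>\<^bsub>B\<^esub>)))
    + (diff_op (A \<times>\<times> B) (?F Q R) P (x \<otimes>\<^bsub>A\<^esub> a, y)
       - diff_op (A \<times>\<times> B) (?F Q R) P ((x \<otimes>\<^bsub>A\<^esub> a, y) \<otimes>\<^bsub>A \<times>\<times> B\<^esub> (\<one>\<^bsub>A\<^esub>, b)))"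
    using car by (simp add: g z)
  also have "diff_op (A \<times>\<times> B) (?F Q R) P (x, y)
       - diff_op (A \<times>\<times> B) (?F Q R) P ((x, y) \<otimes>\<^bsub>A \<times>\<times> B\<^esub> (a, \<one>\<^bsub>B\<^esub>))
    = diff_op (A \<times>\<times> B) (?F (a # Q) R) P (x, y)"
    using car by (intro AB.diff_op_shift[symmetric]) (auto simp: algebra_simps)
  also have "diff_op (A \<times>\<times> B) (?F Q R) P (x \<otimes>\<^bsub>A\<^esub> a, y)
       - diff_op (A \<times>\<times> B) (?F Q R) P ((x \<otimes>\<^bsub>A\<^esub> a, y) \<otimes>\<^bsub>A \<times>\<times> B\<^esub> (\<one>\<^bsub>A\<^esub>, b))
    = diff_op (A \<times>\<times> B) (?F Q (b # R)) P (x \<otimes>\<^bsub>A\<^esub> a, y)"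
    using car by (intro AB.diff_op_shift[symmetric]) (auto simp: algebra_simps)
  finally have eq: "diff_op (A \<times>\<times> B) (?F Q R) (g # P) z
    = diff_op (A \<times>\<times> B) (?F (a # Q) R) P (x, y) + diff_op (A \<times>\<times> B) (?F Q (b # R)) P (x \<otimes>\<^bsub>A\<^esub> a, y)" .
  have "int p dvd diff_op (A \<times>\<times> B) (?F (a # Q) R) P (x, y)"
    using Cons.prems car wa by (intro Cons.IH) auto
  moreover have "int p dvd diff_op (A \<times>\<times> B) (?F Q (b # R)) P (x \<otimes>\<^bsub>A\<^esub> a, y)"
    using Cons.prems car wb by (intro Cons.IH) auto
  ultimately show ?case unfolding eq by (rule dvd_add)
qed

lemma olson_fun_DirProd:
  fixes p :: nat
  assumes "fin_comm_group A" "fin_comm_group B"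
    and f: "olson_fun p A V f" and h: "olson_fun p B W h"
  shows "olson_fun p (A \<times>\<times> B) (V + W) (\<lambda>z. f (fst z) * h (snd z))"
proof -
  have "int p dvd diff_op (A \<times>\<times> B) (\<lambda>z. f (fst z) * h (snd z)) P z"
    if "z \<in> carrier (A \<times>\<times> B)" "set P \<subseteq> carrier (A \<times>\<times> B)"
      "V + W < (\<Sum>g\<leftarrow>P. 1 / real (group.ord (A \<times>\<times> B) g))" for P z
    using olson_fun_DirProd_aux[OF assms that(2), of "[]" "[]" z] that by simp
  moreover have "int p dvd f (fst z) * h (snd z)" if "z \<in> carrier (A \<times>\<times> B)" "z \<noteq> \<one>\<^bsub>A \<times>\<times> B\<^esub>" for z
    using that f h unfolding olson_fun_def by (cases z) auto
  ultimately show ?thesis using f h unfolding olson_fun_def by simp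
qed

section \<open>Binomial coefficients as Olson functions of cyclic p-groups\<close>

lemma prime_power_dvd_mult_imp:
  fixes p :: nat
  assumes "Factorial_Ring.prime p" "p ^ m dvd a * b" "\<not> p dvd b"
  shows "p ^ m dvd a"
proof -
  have "coprime (p ^ m) b" using prime_imp_coprime[OF assms(1,3)] by simp
  then show ?thesis using assms(2) by (simp add: coprime_dvd_mult_left_iff)
qed

text \<open>By i C(g, i) = g C(g - 1, i - 1), if C(g, i) were prime to \<open>p\<close>, then
  \<open>p ^ m\<close> would divide \<open>c * i\<close>, which is positive and too small. In the
  applications \<open>c\<close> is the order of the residue \<open>g\<close>, or
  \<open>c = 1\<close> and \<open>g = p ^ m\<close>.\<close>

lemma prime_dvd_binomial_of_dvd:
  fixes p :: nat
  assumes "Factorial_Ring.prime p" "p ^ m dvd c * g" "0 < i" "0 < c" "c * i < p ^ m"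
  shows "p dvd (g choose i)"
proof (rule ccontr)
  assume n: "\<not> p dvd (g choose i)"
  then have "g > 0" using assms(3) by (cases g) (auto simp: binomial_eq_0)
  then have "i * (g choose i) = g * (g - 1 choose (i - 1))"
    using assms(3) times_binomial_minus1_eq by blast
  then have "c * i * (g choose i) = c * g * (g - 1 choose (i - 1))" by (simp add: mult.assoc)
  then have "p ^ m dvd c * i * (g choose i)" using assms(2) by (metis dvd_mult2)
  then have "p ^ m dvd c * i" using prime_power_dvd_mult_imp assms(1) n by blast
  then show False using assms(3-5) by (auto dest: dvd_imp_le)
qed

context
  fixes p m :: nat and C :: "int monoid"
  assumes p: "Factorial_Ring.prime p"
  defines "C \<equiv> integer_mod_group (p ^ m)"
begin

text \<open>Vandermonde's identity and p | C(p^m, i) for 0 < i < p^m show that y -> C(y, k) has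
  period p^m modulo p. So it is a function on the cyclic group, up to multiples of p.\<close>

lemma binomial_mod_prime_power:
  assumes "k < p ^ m"
  shows "[int ((x mod p ^ m + s) choose k) = int ((x + s) choose k)] (mod int p)"
proof -
  have *: "[(y + p ^ m) choose k = y choose k] (mod p)" for y
  proof -
    have "(y + p ^ m) choose k = (p ^ m + y) choose k" by (simp add: add.commute)
    also have "\<dots> = (\<Sum>i\<le>k. (p ^ m choose i) * (y choose (k - i)))"
      by (simp add: vandermonde)
    also have "[\<dots> = (\<Sum>i\<le>k. if i = 0 then y choose k else 0)] (mod p)"
    proof (rule cong_sum)
      fix i assume i: "i \<in> {..k}"
      show "[(p ^ m choose i) * (y choose (k - i)) = (if i = 0 then y choose k else 0)] (mod p)"
      proof (cases "i = 0")
        case False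
        then have "p dvd (p ^ m choose i)"
          using i assms p by (intro prime_dvd_binomial_of_dvd[of p m 1]) auto
        then show ?thesis using False by (simp add: cong_0_iff)
      qed auto
    qed
    finally show ?thesis by simp
  qed
  have "[(y + j * p ^ m) choose k = y choose k] (mod p)" for y j
  proof (induction j)
    case (Suc j)
    have "[((y + j * p ^ m) + p ^ m) choose k = (y + j * p ^ m) choose k] (mod p)" by (rule *)
    then show ?case using Suc by (simp add: algebra_simps) (metis cong_trans)
  qed simp
  from this[of "x mod p ^ m + s" "x div p ^ m"]
  have "[(x + s) choose k = (x mod p ^ m + s) choose k] (mod p)"
    by (metis add.assoc add.commute mod_div_mult_eq)
  then show ?thesis by (simp add: cong_int_iff cong_sym)
qed

text \<open>Vandermonde's identity expands a translation by \<open>g\<close> into binomials of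
  degree at most \<open>k\<close>; linearity carries the expansion through the difference
  operators.\<close>

lemma diff_op_binomial_shift:
  assumes "k < p ^ m" "g \<in> carrier C" "x \<in> carrier C" "set P \<subseteq> carrier C"
  shows "[diff_op C (\<lambda>x. int ((nat x + s) choose k)) P (x \<otimes>\<^bsub>C\<^esub> g)
     = (\<Sum>i\<le>k. int (nat g choose i) * diff_op C (\<lambda>x. int ((nat x + s) choose (k - i))) P x)] (mod int p)"
  using assms(3,4)
proof (induction P arbitrary: x)
  case Nil
  have q: "p ^ m > 0" using p prime_gt_0_nat by simp
  have nn: "x \<ge> 0" "g \<ge> 0" using Nil assms(2) q by (auto simp: C_def carrier_integer_mod_group)
  have "nat (x \<otimes>\<^bsub>C\<^esub> g) = (nat x + nat g) mod p ^ m"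
    using nn by (simp add: C_def nat_mod_distrib nat_add_distrib nat_power_eq)
  then have "[int ((nat (x \<otimes>\<^bsub>C\<^esub> g) + s) choose k) = int ((nat g + (nat x + s)) choose k)] (mod int p)"
    using binomial_mod_prime_power[OF assms(1), of "nat x + nat g" s] by (simp add: add.commute add.left_commute)
  also have "int ((nat g + (nat x + s)) choose k) = (\<Sum>i\<le>k. int (nat g choose i) * int ((nat x + s) choose (k - i)))"
    by (simp flip: vandermonde of_nat_mult of_nat_sum)
  finally show ?case by simp
next
  case (Cons a P)
  interpret C: comm_group C unfolding C_def by simp
  have "x \<otimes>\<^bsub>C\<^esub> g \<otimes>\<^bsub>C\<^esub> a = x \<otimes>\<^bsub>C\<^esub> a \<otimes>\<^bsub>C\<^esub> g"
    using Cons.prems assms(2) by (simp add: C.m_ac)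
  moreover note Cons.IH[of x] Cons.IH[of "x \<otimes>\<^bsub>C\<^esub> a"]
  ultimately show ?case using Cons.prems
    by (simp add: right_diff_distrib sum_subtractf cong_diff)
qed

text \<open>Modulo p, differencing by \<open>g\<close> lowers the degree by at least p^m / ord(g): a
  smaller drop \<open>i\<close> carries the coefficient C(g, i), which is divisible by p. Measured
  in units of p^m, the degree falls by at least the weight 1/ord(g), so a list of weight above k/p^m
  annihilates degree \<open>k\<close>.\<close>

lemma diff_op_binomial_dvd:
  assumes "k < p ^ m" "x \<in> carrier C" "set P \<subseteq> carrier C"
    "(\<Sum>g\<leftarrow>P. 1 / real (group.ord C g)) > real k / real (p ^ m)"
  shows "int p dvd diff_op C (\<lambda>x. int ((nat x + s) choose k)) P x"
  using assms
proof (induction P arbitrary: k)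
  case Nil
  then show ?case by (simp add: divide_less_0_iff)
next
  case (Cons g P)
  have q: "p ^ m > 0" using p prime_gt_0_nat by simp
  interpret C: fin_comm_group C unfolding C_def using q by (rule fin_comm_group_integer_mod_group)
  have g: "g \<in> carrier C" using Cons.prems by simp
  let ?D = "\<lambda>k. diff_op C (\<lambda>x. int ((nat x + s) choose k)) P x"
  have dv: "int p dvd int (nat g choose i) * ?D (k - i)" if "0 < i" "i \<le> k" for i
  proof (cases "C.ord g * i < p ^ m")
    case True
    have "0 \<le> g" using g q by (auto simp: C_def carrier_integer_mod_group)
    have "(int (C.ord g) * g) mod int (p ^ m) = 0"
      using C.pow_ord_eq_1[OF g] unfolding C_def pow_integer_mod_group by simp
    then have "int (p ^ m) dvd int (C.ord g * nat g)" using \<open>0 \<le> g\<close> by auto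
    then have "p ^ m dvd C.ord g * nat g" by (simp only: int_dvd_int_iff)
    then have "p dvd (nat g choose i)"
      using prime_dvd_binomial_of_dvd p that True C.ord_pos[OF g] by blast
    then show ?thesis by simp
  next
    case False
    then have "real (p ^ m) \<le> real (C.ord g) * real i" by (metis not_less of_nat_le_iff of_nat_mult)
    then have "1 / real (C.ord g) \<le> real i / real (p ^ m)"
      using C.ord_pos[OF g] q by (simp add: field_simps)
    then have "int p dvd ?D (k - i)"
      using Cons.prems that by (intro Cons.IH) (auto simp: diff_divide_distrib of_nat_diff)
    then show ?thesis by simp
  qed
  have "[?D k - diff_op C (\<lambda>x. int ((nat x + s) choose k)) P (x \<otimes>\<^bsub>C\<^esub> g)
     = ?D k - (\<Sum>i\<le>k. int (nat g choose i) * ?D (k - i))] (mod int p)"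
    using diff_op_binomial_shift[of k g x P s] Cons.prems by (intro cong_diff) auto
  \<comment> \<open>The term i = 0 is the untranslated value and cancels against
    \<open>?D k\<close>.\<close>
  also have "(\<Sum>i\<le>k. int (nat g choose i) * ?D (k - i)) = ?D k + (\<Sum>i\<in>{..k} - {0}. int (nat g choose i) * ?D (k - i))"
    by (subst sum.remove[of _ 0]) auto
  also have "?D k - \<dots> = - (\<Sum>i\<in>{..k} - {0}. int (nat g choose i) * ?D (k - i))" by simp
  finally have "[diff_op C (\<lambda>x. int ((nat x + s) choose k)) (g # P) x
     = - (\<Sum>i\<in>{..k} - {0}. int (nat g choose i) * ?D (k - i))] (mod int p)" by simp
  moreover have "int p dvd - (\<Sum>i\<in>{..k} - {0}. int (nat g choose i) * ?D (k - i))"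
    using dv by (auto intro!: dvd_sum)
  ultimately show ?case using cong_dvd_iff by blast
qed

text \<open>The degree p^m - 1 accounts for the bound 1 - 1/p^m. The shift by p^m - 1 makes the
  binomial a delta function modulo p: it is 1 at 0, and for 0 < x < p^m its product with x + p^m is
  divisible by p^m, while x + p^m is not.\<close>

lemma olson_fun_cyclic:
  "olson_fun p C (1 - 1 / real (p ^ m)) (\<lambda>x. int ((nat x + (p ^ m - 1)) choose (p ^ m - 1)))"
proof -
  have q: "p ^ m > 0" using p prime_gt_0_nat by simp
  have "int p dvd int ((nat x + (p ^ m - 1)) choose (p ^ m - 1))" if "x \<in> carrier C" "x \<noteq> 0" for x
  proof (rule ccontr)
    assume "\<not> ?thesis"
    then have n: "\<not> p dvd ((nat x + (p ^ m - 1)) choose (p ^ m - 1))" by auto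
    have x: "0 < x" "x < int (p ^ m)" using that q by (auto simp: C_def carrier_integer_mod_group)
    have "p ^ m * ((nat x + p ^ m) choose (p ^ m)) = (nat x + p ^ m) * ((nat x + p ^ m - 1) choose (p ^ m - 1))"
      using q times_binomial_minus1_eq by blast
    then have "p ^ m dvd (nat x + p ^ m) * ((nat x + (p ^ m - 1)) choose (p ^ m - 1))"
      using q by (metis Nat.add_diff_assoc dvd_triv_left less_eq_Suc_le One_nat_def)
    then have "p ^ m dvd nat x + p ^ m" using prime_power_dvd_mult_imp p n by blast
    then have "p ^ m dvd nat x" by simp
    then have "p ^ m \<le> nat x" using x by (auto dest: dvd_imp_le)
    then show False using x by linarith
  qed
  moreover have "int p dvd diff_op C (\<lambda>x. int ((nat x + (p ^ m - 1)) choose (p ^ m - 1))) P x"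
    if "x \<in> carrier C" "set P \<subseteq> carrier C" "1 - 1 / real (p ^ m) < (\<Sum>g\<leftarrow>P. 1 / real (group.ord C g))" for P x
  proof (rule diff_op_binomial_dvd)
    have rp: "real (p ^ m - 1) = real (p ^ m) - 1"
      using q by (metis One_nat_def Suc_leI of_nat_1 of_nat_diff)
    have "real (p ^ m - 1) / real (p ^ m) = 1 - 1 / real (p ^ m)"
      using q rp by (simp add: diff_divide_distrib del: of_nat_power)
    then show "real (p ^ m - 1) / real (p ^ m) < (\<Sum>g\<leftarrow>P. 1 / real (group.ord C g))"
      using that by simp
  qed (use that q in auto)
  ultimately show ?thesis unfolding olson_fun_def by (simp add: C_def)
qed

end

section \<open>Olson functions applied to zero-sum free sequences\<close>

context fin_comm_group
begin

text \<open>\<open>diff_op G f P x\<close> is a signed sum of values of \<open>f\<close> at the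
  products of \<open>x\<close> with the subsums of \<open>P\<close>. If none of these products is
  the identity, every summand is divisible by \<open>p\<close>.\<close>

lemma diff_op_dvd_of_no_one:
  assumes "olson_fun p G W f" "x \<in> carrier G" "set P \<subseteq> carrier G"
    "\<And>T. T \<subseteq># mset P \<Longrightarrow> x \<otimes> seq_sum G T \<noteq> \<one>"
  shows "int p dvd diff_op G f P x"
  using assms(2-)
proof (induction P arbitrary: x)
  case Nil
  then show ?case using assms(1) Nil(3)[of "{#}"] by (auto simp: olson_fun_def)
next
  case (Cons g P)
  have "int p dvd diff_op G f P x"
  proof (rule Cons.IH)
    fix T assume "T \<subseteq># mset P"
    then show "x \<otimes> seq_sum G T \<noteq> \<one>"
      by (intro Cons.prems(3)) (simp_all add: subset_mset_add_msetI)
  qed (use Cons.prems in auto)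
  moreover have "int p dvd diff_op G f P (x \<otimes> g)"
  proof (rule Cons.IH)
    fix T assume T: "T \<subseteq># mset P"
    then have "set_mset T \<subseteq> carrier G" using Cons.prems(2) set_mset_mono by fastforce
    then show "x \<otimes> g \<otimes> seq_sum G T \<noteq> \<one>"
      using Cons.prems(1,2) Cons.prems(3)[of "add_mset g T"] T by (simp add: m_assoc)
  qed (use Cons.prems in auto)
  ultimately show ?case by simp
qed

text \<open>Every nonempty subsequence contributes a multiple of \<open>p\<close> to the signed sum,
  which leaves the value \<open>f x\<close> of the empty one.\<close>

lemma diff_op_cong_of_zero_sum_free:
  assumes "olson_fun p G W f" "x \<in> carrier G" "set P \<subseteq> carrier G"
    "\<And>T. T \<subseteq># mset P \<Longrightarrow> T \<noteq> {#} \<Longrightarrow> x \<otimes> seq_sum G T \<noteq> \<one>"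
  shows "[diff_op G f P x = f x] (mod int p)"
  using assms(2-)
proof (induction P arbitrary: x)
  case (Cons g P)
  have "[diff_op G f P x = f x] (mod int p)"
  proof (rule Cons.IH)
    fix T assume "T \<subseteq># mset P" "T \<noteq> {#}"
    then show "x \<otimes> seq_sum G T \<noteq> \<one>"
      by (intro Cons.prems(3)) (simp_all add: subset_mset_add_msetI)
  qed (use Cons.prems in auto)
  moreover have "int p dvd diff_op G f P (x \<otimes> g)"
  proof (rule diff_op_dvd_of_no_one[OF assms(1)])
    fix T assume T: "T \<subseteq># mset P"
    then have "set_mset T \<subseteq> carrier G" using Cons.prems(2) set_mset_mono by fastforce
    then show "x \<otimes> g \<otimes> seq_sum G T \<noteq> \<one>"
      using Cons.prems(1,2) Cons.prems(3)[of "add_mset g T"] T by (simp add: m_assoc)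
  qed (use Cons.prems in auto)
  ultimately show ?case by (metis cong_diff cong_0_iff diff_zero diff_op.simps(2))
qed simp

lemma not_dvd_diff_op_of_zero_sum_free:
  assumes "Factorial_Ring.prime p" "olson_fun p G W f" "set P \<subseteq> carrier G" "zero_sum_free G (mset P)"
  shows "\<not> int p dvd diff_op G f P \<one>"
proof
  assume "int p dvd diff_op G f P \<one>"
  have "\<one> \<otimes> seq_sum G T \<noteq> \<one>" if "T \<subseteq># mset P" "T \<noteq> {#}" for T
  proof -
    have "set_mset T \<subseteq> carrier G" using that assms(3) set_mset_mono by fastforce
    then show ?thesis using that assms(4) by (simp add: zero_sum_free_def)
  qed
  then have "[diff_op G f P \<one> = f \<one>] (mod int p)"
    using diff_op_cong_of_zero_sum_free[OF assms(2) _ assms(3), of \<one>] by blast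
  then have "int p dvd 1"
    using \<open>int p dvd diff_op G f P \<one>\<close> assms(2) by (simp add: olson_fun_def cong_dvd_iff)
  then show False using assms(1) prime_gt_1_nat by force
qed

text \<open>For a zero-sum free sequence of weight above \<open>W\<close>, the difference at the
  identity would be divisible by \<open>p\<close> because of the weight, yet congruent to 1 because
  no subsum vanishes.\<close>

lemma cross_number_le_olson:
  assumes "Factorial_Ring.prime p" "olson_fun p G W f" "set_mset S \<subseteq> carrier G" "zero_sum_free G S"
  shows "cross_number G S \<le> W"
proof (rule ccontr)
  assume gt: "\<not> cross_number G S \<le> W"
  obtain P where P: "mset P = S" using ex_mset by blast
  then have "set P \<subseteq> carrier G" using assms(3) by auto
  moreover have "(\<Sum>g\<leftarrow>P. 1 / real (ord g)) = cross_number G S"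
    using cross_number_eq[OF assms(3)] P by (metis mset_map sum_mset_sum_list)
  ultimately have "int p dvd diff_op G f P \<one>"
    using assms(2) gt by (auto simp: olson_fun_def)
  then show False
    using not_dvd_diff_op_of_zero_sum_free[OF assms(1,2) \<open>set P \<subseteq> carrier G\<close>] P assms(4) by blast
qed

end

section \<open>Short zero-sum subsequences in rank two\<close>

text \<open>In exponent p every term weighs at least 1/p, so length bounds the cross number from
  below. The labelling \<phi> lets the block be chosen from \<open>S\<close> itself, whose elements
  carry more data than their images.\<close>

lemma (in fin_comm_group) zero_sum_of_large_size:
  assumes "Factorial_Ring.prime p" "olson_fun p G W f" "\<And>x. x \<in> carrier G \<Longrightarrow> x [^] p = \<one>"
    and "\<And>s. s \<in># S \<Longrightarrow> \<phi> s \<in> carrier G" "real (size S) > W * real p"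
  obtains T where "T \<subseteq># S" "T \<noteq> {#}" "seq_sum G (image_mset \<phi> T) = \<one>"
proof -
  have p: "p > 0" using assms(1) prime_gt_0_nat by blast
  have car: "set_mset (image_mset \<phi> S) \<subseteq> carrier G" using assms(4) by auto
  have "1 / real p \<le> 1 / real (ord (\<phi> s))" if "s \<in># S" for s
  proof -
    have "ord (\<phi> s) \<le> p" using assms(3,4) that p by (metis dvd_imp_le pow_eq_id)
    then show ?thesis using ord_pos[OF assms(4)[OF that]] by (intro divide_left_mono) auto
  qed
  then have "(\<Sum>s\<in>#S. 1 / real p) \<le> (\<Sum>s\<in>#S. 1 / real (ord (\<phi> s)))"
    by (rule sum_mset_mono_real)
  also have "\<dots> = cross_number G (image_mset \<phi> S)"
    using cross_number_eq[OF car] by (simp add: image_mset.compositionality o_def)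
  finally have "real (size S) / real p \<le> cross_number G (image_mset \<phi> S)" by simp
  moreover have "W < real (size S) / real p" using assms(5) p by (simp add: field_simps)
  ultimately have "\<not> zero_sum_free G (image_mset \<phi> S)"
    using cross_number_le_olson[OF assms(1,2) car] by linarith
  then obtain T where "T \<subseteq># image_mset \<phi> S" "T \<noteq> {#}" "seq_sum G T = \<one>"
    unfolding zero_sum_free_def by blast
  then show ?thesis using that by (elim subset_mset_image_msetE) auto
qed

lemma seq_sum_integer_mod_group:
  assumes "n > 0" "set_mset S \<subseteq> carrier (integer_mod_group n)"
  shows "seq_sum (integer_mod_group n) S = \<Sum>\<^sub># S mod int n"
proof -
  interpret fin_comm_group "integer_mod_group n" using assms(1) by (rule fin_comm_group_integer_mod_group)
  show ?thesis using assms(2) by (induction S) (auto simp: mod_simps)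
qed

lemma sum_mset_mod_eq:
  "(\<Sum>x\<in>#S. f x mod k) mod k = (\<Sum>x\<in>#S. f x :: int) mod k"
  by (induction S) (auto simp: mod_simps intro: mod_add_cong)

context
  fixes p :: nat
  assumes p: "Factorial_Ring.prime p"
begin

private abbreviation (input) "Z \<equiv> integer_mod_group p"

private lemma p_pos: "p > 0" using p prime_gt_0_nat by blast

private lemma Z_fin: "fin_comm_group Z" by (rule fin_comm_group_integer_mod_group[OF p_pos])

private lemma Z_olson: "\<exists>f. olson_fun p Z (1 - 1 / real p) f"
  using olson_fun_cyclic[OF p, of 1] by auto

private lemma Z_mem: "k mod int p \<in> carrier Z" using p_pos by (simp add: carrier_integer_mod_group)

private lemma Z_seq_sum:
  "seq_sum Z {#\<psi> x mod int p. x \<in># T#} = 0 \<longleftrightarrow> int p dvd (\<Sum>x\<in>#T. \<psi> x)"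
  by (subst seq_sum_integer_mod_group)
    (use p_pos Z_mem in \<open>auto simp: sum_mset_mod_eq mod_eq_0_iff_dvd\<close>)

lemma cyclic_zero_sum:
  assumes "size S \<ge> p"
  obtains T where "T \<subseteq># S" "T \<noteq> {#}" "size T \<le> p" "int p dvd (\<Sum>x\<in>#T. \<psi> x)"
proof -
  \<comment> \<open>Keeping exactly p terms gives the bound on the length of the block.\<close>
  obtain S' where S': "S' \<subseteq># S" "size S' = p" using subset_mset_of_size assms by blast
  interpret fin_comm_group Z by (rule Z_fin)
  obtain f where f: "olson_fun p Z (1 - 1 / real p) f" using Z_olson by blast
  obtain T where "T \<subseteq># S'" "T \<noteq> {#}" "seq_sum Z {#\<psi> x mod int p. x \<in># T#} = \<one>\<^bsub>Z\<^esub>"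
    by (rule zero_sum_of_large_size[OF p f, of S' "\<lambda>x. \<psi> x mod int p"])
      (use S' p_pos Z_mem in \<open>auto simp: field_simps\<close>)
  moreover from this have "size T \<le> p" "T \<subseteq># S"
    using S' size_mset_mono[of T S'] by (auto intro: subset_mset.order_trans)
  ultimately show ?thesis using that by (simp add: Z_seq_sum)
qed

text \<open>The product Olson function has W = 2 - 2/p, so W p = 2p - 2 is one less than the
  required length. The cyclic and the rank three versions rest on the same count, with p - 1 and 3p
  - 3.\<close>

lemma rank2_zero_sum:
  assumes "size S \<ge> 2 * p - 1"
  obtains T where "T \<subseteq># S" "T \<noteq> {#}" "int p dvd (\<Sum>x\<in>#T. \<psi> x)" "int p dvd (\<Sum>x\<in>#T. \<psi>' x)"
proof -
  note F2 = fin_comm_group_DirProd[OF Z_fin Z_fin]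
  interpret fin_comm_group "Z \<times>\<times> Z" by (rule F2)
  obtain f where f: "olson_fun p Z (1 - 1 / real p) f" using Z_olson by blast
  let ?\<phi> = "\<lambda>x. (\<psi> x mod int p, \<psi>' x mod int p)"
  have "(1 - 1 / real p + (1 - 1 / real p)) * real p = 2 * real p - 2"
    using p_pos by (simp add: algebra_simps)
  then have large: "(1 - 1 / real p + (1 - 1 / real p)) * real p < real (size S)"
    using assms p_pos by linarith
  obtain T where T: "T \<subseteq># S" "T \<noteq> {#}" "seq_sum (Z \<times>\<times> Z) (image_mset ?\<phi> T) = \<one>\<^bsub>Z \<times>\<times> Z\<^esub>"
    by (rule zero_sum_of_large_size[OF p olson_fun_DirProd[OF Z_fin Z_fin f f], of S ?\<phi>])
      (use large Z_mem in \<open>auto simp: DirProd_nat_pow\<close>)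
  have "seq_sum (Z \<times>\<times> Z) (image_mset ?\<phi> T)
      = (seq_sum Z {#\<psi> x mod int p. x \<in># T#}, seq_sum Z {#\<psi>' x mod int p. x \<in># T#})"
    by (subst seq_sum_DirProd[OF Z_fin Z_fin])
      (use Z_mem in \<open>auto simp: image_mset.compositionality o_def\<close>)
  then show ?thesis using that T by (simp add: Z_seq_sum)
qed

lemma rank3_zero_sum:
  assumes "size S \<ge> 3 * p - 2"
  obtains T where "T \<subseteq># S" "T \<noteq> {#}"
    "int p dvd (\<Sum>x\<in>#T. \<psi> x)" "int p dvd (\<Sum>x\<in>#T. \<psi>' x)" "int p dvd (\<Sum>x\<in>#T. \<psi>'' x)"
proof -
  note F2 = fin_comm_group_DirProd[OF Z_fin Z_fin]
  note F3 = fin_comm_group_DirProd[OF Z_fin F2]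
  interpret fin_comm_group "Z \<times>\<times> Z \<times>\<times> Z" by (rule F3)
  obtain f where f: "olson_fun p Z (1 - 1 / real p) f" using Z_olson by blast
  have "(1 - 1 / real p + (1 - 1 / real p + (1 - 1 / real p))) * real p = 3 * real p - 3"
    using p_pos by (simp add: algebra_simps)
  then have large: "(1 - 1 / real p + (1 - 1 / real p + (1 - 1 / real p))) * real p < real (size S)"
    using assms p_pos by linarith
  let ?\<phi>2 = "\<lambda>x. (\<psi>' x mod int p, \<psi>'' x mod int p)"
  let ?\<phi> = "\<lambda>x. (\<psi> x mod int p, \<psi>' x mod int p, \<psi>'' x mod int p)"
  obtain T where T: "T \<subseteq># S" "T \<noteq> {#}" "seq_sum (Z \<times>\<times> Z \<times>\<times> Z) (image_mset ?\<phi> T) = \<one>\<^bsub>Z \<times>\<times> Z \<times>\<times> Z\<^esub>"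
    by (rule zero_sum_of_large_size
          [OF p olson_fun_DirProd[OF Z_fin F2 f olson_fun_DirProd[OF Z_fin Z_fin f f]], of S ?\<phi>])
      (use large Z_mem in \<open>auto simp: DirProd_nat_pow\<close>)
  have "seq_sum (Z \<times>\<times> Z) (image_mset ?\<phi>2 T)
      = (seq_sum Z {#\<psi>' x mod int p. x \<in># T#}, seq_sum Z {#\<psi>'' x mod int p. x \<in># T#})"
    by (subst seq_sum_DirProd[OF Z_fin Z_fin])
      (use Z_mem in \<open>auto simp: image_mset.compositionality o_def\<close>)
  moreover have "seq_sum (Z \<times>\<times> Z \<times>\<times> Z) (image_mset ?\<phi> T)
      = (seq_sum Z {#\<psi> x mod int p. x \<in># T#}, seq_sum (Z \<times>\<times> Z) (image_mset ?\<phi>2 T))"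
    by (subst seq_sum_DirProd[OF Z_fin F2])
      (use Z_mem in \<open>auto simp: image_mset.compositionality o_def\<close>)
  ultimately show ?thesis using that T by (simp add: Z_seq_sum)
qed

text \<open>The third coordinate, constantly 1, forces the length to be a multiple of \<open>p\<close>; a zero-sum
  subsequence of length \<open>2p\<close> splits into two zero-sum subsequences, since \<open>2p - 1\<close> of its terms
  already contain one.\<close>

lemma rank2_short_zero_sum:
  assumes "size S \<ge> 3 * p - 2"
  obtains T where "T \<subseteq># S" "T \<noteq> {#}" "size T \<le> p"
    "int p dvd (\<Sum>x\<in>#T. \<psi> x)" "int p dvd (\<Sum>x\<in>#T. \<psi>' x)"
proof -
  \<comment> \<open>Among exactly 3p - 2 terms, a nonempty block whose length is a multiple of p has
    length p or 2p.\<close>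
  obtain S' where S': "S' \<subseteq># S" "size S' = 3 * p - 2" using subset_mset_of_size assms by blast
  then obtain T where T: "T \<subseteq># S'" "T \<noteq> {#}"
    "int p dvd (\<Sum>x\<in>#T. \<psi> x)" "int p dvd (\<Sum>x\<in>#T. \<psi>' x)" "int p dvd (\<Sum>x\<in>#T. 1)"
    using rank3_zero_sum[of S' \<psi> \<psi>' "\<lambda>_. 1"] by auto
  have TS: "T \<subseteq># S" using T S' by (meson subset_mset.order_trans)
  have "p dvd size T" using T(5) by simp
  then obtain k where k: "size T = p * k" by blast
  have "size T \<le> 3 * p - 2" using T(1) S'(2) size_mset_mono by force
  then have "p * k < p * 3" using k p_pos by linarith
  then have "k < 3" by simp
  show ?thesis
  proof (cases "k \<le> 1")
    case True
    then show ?thesis using that TS T k by (cases k) auto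
  next
    case False
    then have keq: "k = 2" using \<open>k < 3\<close> by simp
    have k2: "size T = 2 * p" using k keq by simp
    \<comment> \<open>Setting \<open>x\<close> aside leaves 2p - 1 terms and keeps the complement of
      the block \<open>U\<close> nonempty.\<close>
    obtain x T' where x: "T = add_mset x T'" using T(2) multiset_cases by blast
    then have "size T' \<ge> 2 * p - 1" using k2 by auto
    then obtain U where U: "U \<subseteq># T'" "U \<noteq> {#}" "int p dvd (\<Sum>x\<in>#U. \<psi> x)" "int p dvd (\<Sum>x\<in>#U. \<psi>' x)"
      using rank2_zero_sum[of T' \<psi> \<psi>'] by blast
    define V where "V = T - U"
    have UT: "U \<subseteq># T" using U(1) x by (simp add: subset_mset_add_msetI)
    then have TUV: "T = U + V" by (simp add: V_def)
    have "V \<noteq> {#}" using U(1) x TUV size_mset_mono[OF U(1)] by auto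
    moreover have "int p dvd (\<Sum>x\<in>#V. \<psi> x)" "int p dvd (\<Sum>x\<in>#V. \<psi>' x)"
      using T(3,4) U(3,4) unfolding TUV by (auto simp: dvd_add_right_iff)
    moreover have "size U \<le> p \<or> size V \<le> p" using k2 TUV by auto
    moreover have "U \<subseteq># S" "V \<subseteq># S" using TS TUV
      by (metis mset_subset_eq_add_left mset_subset_eq_add_right subset_mset.order_trans)+
    ultimately show ?thesis using that U by blast
  qed
qed

text \<open>For \<open>c\<close> in the p^i-torsion of C_{p^m}, the integer p^i c / p^m taken modulo
  p is the class of \<open>c\<close> modulo the p^(i-1)-torsion. If these digits add up to 0 modulo
  p, the sum of the block lies in the p^(i-1)-torsion.\<close>

lemma cyclic_pow_of_digit_sum:
  fixes S :: "'a multiset" and i m :: nat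
  assumes i: "i \<ge> 1" and "\<And>x. x \<in># S \<Longrightarrow> c x \<in> carrier (integer_mod_group (p ^ m))"
    and "\<And>x. x \<in># S \<Longrightarrow> c x [^]\<^bsub>integer_mod_group (p ^ m)\<^esub> (p ^ i) = \<one>\<^bsub>integer_mod_group (p ^ m)\<^esub>"
    and "int p dvd (\<Sum>x\<in>#S. (int (p ^ i) * c x) div int (p ^ m))"
  shows "seq_sum (integer_mod_group (p ^ m)) (image_mset c S) [^]\<^bsub>integer_mod_group (p ^ m)\<^esub> (p ^ (i - 1))
           = \<one>\<^bsub>integer_mod_group (p ^ m)\<^esub>"
proof -
  have q: "p ^ m > 0" using p_pos by simp
  have "int (p ^ m) dvd int (p ^ i) * c x" if "x \<in># S" for x
    using assms(3)[OF that] unfolding pow_integer_mod_group one_integer_mod_group by (rule dvd_eq_mod_eq_0[THEN iffD2])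
  then have "int (p ^ i) * (\<Sum>x\<in>#S. c x) = int (p ^ m) * (\<Sum>x\<in>#S. (int (p ^ i) * c x) div int (p ^ m))"
  proof (induction S)
    case (add x S)
    have "int (p ^ m) * ((int (p ^ i) * c x) div int (p ^ m)) = int (p ^ i) * c x"
      using add.prems by (intro dvd_mult_div_cancel) auto
    then show ?case using add by (simp add: distrib_left del: of_nat_power)
  qed simp
  also have "int (p ^ m) * int p dvd \<dots>" using assms(4) by (intro mult_dvd_mono) auto
  finally have "int p * int (p ^ m) dvd int p * (int (p ^ (i - 1)) * (\<Sum>x\<in>#S. c x))"
    using i by (cases i) (auto simp: mult_ac)
  then have d: "int (p ^ m) dvd int (p ^ (i - 1)) * (\<Sum>x\<in>#S. c x)"
    using p_pos by (subst (asm) dvd_mult_cancel_left) auto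
  have "set_mset (image_mset c S) \<subseteq> carrier (integer_mod_group (p ^ m))" using assms(2) by auto
  then have "seq_sum (integer_mod_group (p ^ m)) (image_mset c S) = (\<Sum>x\<in>#S. c x) mod int (p ^ m)"
    by (rule seq_sum_integer_mod_group[OF q])
  then show ?thesis using d unfolding pow_integer_mod_group one_integer_mod_group
    by (simp add: mod_mult_right_eq dvd_eq_mod_eq_0 del: of_nat_power)
qed

text \<open>The two digits embed H[p^i] / H[p^(i-1)] in C_p + C_p, where 3p - 2 terms contain a
  zero-sum block of length at most p.\<close>

lemma rank2_short_order_drop:
  fixes m n i :: nat
  defines "H \<equiv> integer_mod_group (p ^ m) \<times>\<times> integer_mod_group (p ^ n)"
  assumes "i \<ge> 1" "set_mset S \<subseteq> carrier H" "\<And>x. x \<in># S \<Longrightarrow> x [^]\<^bsub>H\<^esub> (p ^ i) = \<one>\<^bsub>H\<^esub>"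
    "size S \<ge> 3 * p - 2"
  obtains T where "T \<subseteq># S" "T \<noteq> {#}" "size T \<le> p" "seq_sum H T [^]\<^bsub>H\<^esub> (p ^ (i - 1)) = \<one>\<^bsub>H\<^esub>"
proof -
  let ?\<psi> = "\<lambda>x. (int (p ^ i) * fst x) div int (p ^ m)"
  let ?\<psi>' = "\<lambda>x. (int (p ^ i) * snd x) div int (p ^ n)"
  obtain T where T: "T \<subseteq># S" "T \<noteq> {#}" "size T \<le> p"
    "int p dvd (\<Sum>x\<in>#T. ?\<psi> x)" "int p dvd (\<Sum>x\<in>#T. ?\<psi>' x)"
    using rank2_short_zero_sum[OF assms(5)] by blast
  have inS: "x \<in># S" if "x \<in># T" for x using T(1) that by (rule mset_subset_eqD)
  have xc: "fst x \<in> carrier (integer_mod_group (p ^ m))" "snd x \<in> carrier (integer_mod_group (p ^ n))"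
    if "x \<in># T" for x using inS[OF that] assms(3) by (auto simp: H_def)
  have xp: "fst x [^]\<^bsub>integer_mod_group (p ^ m)\<^esub> (p ^ i) = \<one>\<^bsub>integer_mod_group (p ^ m)\<^esub>"
    "snd x [^]\<^bsub>integer_mod_group (p ^ n)\<^esub> (p ^ i) = \<one>\<^bsub>integer_mod_group (p ^ n)\<^esub>" if "x \<in># T" for x
    using assms(4)[OF inS[OF that]] unfolding H_def
    by (metis DirProd_nat_pow one_DirProd prod.collapse prod.inject)+
  have "set_mset T \<subseteq> carrier (integer_mod_group (p ^ m)) \<times> carrier (integer_mod_group (p ^ n))"
    using xc by (auto simp: mem_Times_iff)
  then have "seq_sum H T = (seq_sum (integer_mod_group (p ^ m)) (image_mset fst T),
     seq_sum (integer_mod_group (p ^ n)) (image_mset snd T))"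
    unfolding H_def using p_pos by (intro seq_sum_DirProd fin_comm_group_integer_mod_group) auto
  moreover have "seq_sum (integer_mod_group (p ^ m)) (image_mset fst T) [^]\<^bsub>integer_mod_group (p ^ m)\<^esub> (p ^ (i - 1))
           = \<one>\<^bsub>integer_mod_group (p ^ m)\<^esub>"
    using assms(2) xc xp T(4) by (intro cyclic_pow_of_digit_sum)
  moreover have "seq_sum (integer_mod_group (p ^ n)) (image_mset snd T) [^]\<^bsub>integer_mod_group (p ^ n)\<^esub> (p ^ (i - 1))
           = \<one>\<^bsub>integer_mod_group (p ^ n)\<^esub>"
    using assms(2) xc xp T(5) by (intro cyclic_pow_of_digit_sum)
  ultimately have "seq_sum H T [^]\<^bsub>H\<^esub> (p ^ (i - 1)) = \<one>\<^bsub>H\<^esub>"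
    by (simp add: H_def DirProd_nat_pow del: pow_integer_mod_group one_integer_mod_group)
  then show ?thesis using that T by blast
qed

end

section \<open>The upper bound\<close>

lemma geometric_tail_le:
  fixes p :: nat
  assumes "p > 0"
  shows "(real p - 1) * (\<Sum>i\<in>{j<..M}. 1 / real p ^ i) \<le> 1 / real p ^ j"
proof (cases "j \<le> M")
  case True
  then have "(real p - 1) * (\<Sum>i\<in>{j<..M}. 1 / real p ^ i) = 1 / real p ^ j - 1 / real p ^ M"
  proof (induction M rule: dec_induct)
    case (step M)
    have "{j<..Suc M} = insert (Suc M) {j<..M}" using step.hyps by auto
    then have "(real p - 1) * (\<Sum>i\<in>{j<..Suc M}. 1 / real p ^ i)
      = (real p - 1) / real p ^ Suc M + (1 / real p ^ j - 1 / real p ^ M)"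
      using step.IH by (simp add: distrib_left)
    also have "\<dots> = 1 / real p ^ j - 1 / real p ^ Suc M" using assms by (simp add: field_simps)
    finally show ?case .
  qed simp
  also have "\<dots> \<le> 1 / real p ^ j" by simp
  finally show ?thesis .
qed simp

text \<open>This isolates the properties of C_{p^m} + C_{p^n} on which the upper bound rests; the
  constant in \<open>short\<close> reflects rank two. The sum in \<open>reciprocal_sum\<close> runs
  over the distinct orders of nontrivial elements, not over the elements.\<close>

locale cross_setting = H: fin_comm_group H + G: fin_comm_group G
  for H :: "('h, 'x) monoid_scheme" and G :: "('g, 'y) monoid_scheme" +
  fixes p :: nat and W :: real and f :: "'h \<Rightarrow> int"
  assumes p: "Factorial_Ring.prime p"
    and olson: "olson_fun p H W f"
    and ord_H: "\<And>x. x \<in> carrier H \<Longrightarrow> \<exists>i. H.ord x = p ^ i"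
    and ord_G: "\<And>g. g \<in> carrier G \<Longrightarrow> \<not> p dvd G.ord g"
    and short: "\<And>i S. i \<ge> 1 \<Longrightarrow> set_mset S \<subseteq> carrier H \<Longrightarrow>
      (\<And>x. x \<in># S \<Longrightarrow> x [^]\<^bsub>H\<^esub> (p ^ i) = \<one>\<^bsub>H\<^esub>) \<Longrightarrow> size S \<ge> 3 * p - 2 \<Longrightarrow>
      \<exists>T. T \<subseteq># S \<and> T \<noteq> {#} \<and> size T \<le> p \<and> seq_sum H T [^]\<^bsub>H\<^esub> (p ^ (i - 1)) = \<one>\<^bsub>H\<^esub>"
    and reciprocal_sum: "(\<Sum>d\<in>G.ord ` (carrier G - {\<one>\<^bsub>G\<^esub>}). 1 / real d) \<le> 1 / (2 * real p + 1)"
begin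

section \<open>Sequences over H + G and their projections\<close>

abbreviation "K \<equiv> H \<times>\<times> G"

definition "sH U = seq_sum H (image_mset fst U)"

definition "sG U = seq_sum G (image_mset snd U)"

abbreviation "weight z \<equiv> 1 / (real (H.ord (fst z)) * real (G.ord (snd z)))"

definition "E = (\<Sum>d\<in>G.ord ` (carrier G - {\<one>\<^bsub>G\<^esub>}). 1 / real d)"

definition "over R \<longleftrightarrow> set_mset R \<subseteq> carrier H \<times> carrier G"

text \<open>For a subgroup \<open>L\<close> this says that the image of the sequence in (H/L) + G is
  zero-sum free, without forming the quotient. For trivial \<open>L\<close> it is zero-sum freeness
  itself.\<close>

definition "avoids L R \<longleftrightarrow> (\<forall>U. U \<subseteq># R \<longrightarrow> U \<noteq> {#} \<longrightarrow> sG U = \<one>\<^bsub>G\<^esub> \<longrightarrow> sH U \<notin> L)"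

lemma p_gt_1: "p > 1" using p prime_gt_1_nat by blast

sublocale K: fin_comm_group K
  by (rule fin_comm_group_DirProd) unfold_locales

lemma over_fst: "over R \<Longrightarrow> set_mset (image_mset fst R) \<subseteq> carrier H"
  and over_snd: "over R \<Longrightarrow> set_mset (image_mset snd R) \<subseteq> carrier G"
  by (auto simp: over_def)

lemma over_subset: "over R \<Longrightarrow> U \<subseteq># R \<Longrightarrow> over U"
  unfolding over_def by (meson set_mset_mono subset_trans)

lemma over_add_mset [simp]: "over (add_mset z R) \<longleftrightarrow> fst z \<in> carrier H \<and> snd z \<in> carrier G \<and> over R"
  by (auto simp: over_def mem_Times_iff)

lemma over_union [simp]: "over (R + U) \<longleftrightarrow> over R \<and> over U"
  by (auto simp: over_def)

lemma sums_closed [simp]: "over U \<Longrightarrow> sH U \<in> carrier H" "over U \<Longrightarrow> sG U \<in> carrier G"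
  using over_fst over_snd by (auto simp: sH_def sG_def)

lemma sums_add_mset [simp]:
  assumes "fst z \<in> carrier H" "snd z \<in> carrier G" "over U"
  shows "sH (add_mset z U) = fst z \<otimes>\<^bsub>H\<^esub> sH U" "sG (add_mset z U) = snd z \<otimes>\<^bsub>G\<^esub> sG U"
  using assms over_fst[OF assms(3)] over_snd[OF assms(3)] by (auto simp: sH_def sG_def)

lemma sums_union [simp]:
  assumes "over T" "over U"
  shows "sH (T + U) = sH T \<otimes>\<^bsub>H\<^esub> sH U" "sG (T + U) = sG T \<otimes>\<^bsub>G\<^esub> sG U"
  using assms[THEN over_fst] assms[THEN over_snd] by (auto simp: sH_def sG_def)

lemma coprime_ords:
  assumes "x \<in> carrier H" "g \<in> carrier G"
  shows "coprime (H.ord x) (G.ord g)"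
  using ord_H[OF assms(1)] prime_imp_coprime[OF p ord_G[OF assms(2)]] by auto

lemma ord_K:
  assumes "z \<in> carrier H \<times> carrier G"
  shows "K.ord z = H.ord (fst z) * G.ord (snd z)"
proof -
  have "K.ord (fst z, snd z) = lcm (H.ord (fst z)) (G.ord (snd z))"
    using assms by (intro ord_DirProd) (auto intro: H.is_group G.is_group)
  then show ?thesis using assms coprime_ords[of "fst z" "snd z"] by (auto simp: lcm_coprime)
qed

lemma cross_K:
  assumes "over R"
  shows "cross_number K R = (\<Sum>z\<in>#R. weight z)"
proof -
  have "set_mset R \<subseteq> carrier K" using assms by (auto simp: over_def)
  then have "cross_number K R = (\<Sum>z\<in>#R. 1 / real (K.ord z))" by (rule K.cross_number_eq)
  also have "{#1 / real (K.ord z). z \<in># R#} = {#weight z. z \<in># R#}"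
    using assms by (intro image_mset_cong) (auto simp: over_def ord_K)
  finally show ?thesis .
qed

lemma zero_sum_free_iff_avoids:
  assumes "over R"
  shows "zero_sum_free K R \<longleftrightarrow> avoids {\<one>\<^bsub>H\<^esub>} R"
proof -
  have "seq_sum K U = (sH U, sG U)" if "U \<subseteq># R" for U
    using over_subset[OF assms that] unfolding over_def sH_def sG_def
    by (intro seq_sum_DirProd) unfold_locales
  then show ?thesis unfolding zero_sum_free_def avoids_def by auto
qed

lemma avoids_subset: "avoids L R \<Longrightarrow> U \<subseteq># R \<Longrightarrow> avoids L U"
  unfolding avoids_def by (meson subset_mset.order_trans)

text \<open>A subsequence using the new term becomes a subsequence of \<open>R\<close> when that
  term is expanded back into \<open>T\<close>; its sum changes only by \<open>l\<close>, an element
  of \<open>L\<close>. The factor \<open>l\<close> allows both ways of amalgamating: keeping the sum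
  of the block, or discarding its H-component when that lies in \<open>L\<close>.\<close>

lemma avoids_amalgamate:
  assumes "subgroup L H" "over R" "avoids L R" "T \<subseteq># R" "T \<noteq> {#}"
    and "l \<in> L" "a \<in> carrier H" "sH T = l \<otimes>\<^bsub>H\<^esub> a"
  shows "avoids L (add_mset (a, sG T) (R - T))"
  unfolding avoids_def
proof (intro allI impI notI)
  fix U assume U: "U \<subseteq># add_mset (a, sG T) (R - T)" "U \<noteq> {#}" "sG U = \<one>\<^bsub>G\<^esub>" "sH U \<in> L"
  have oT: "over T" using over_subset assms by blast
  have sub: "R - T \<subseteq># R" by simp
  show False
  using U(1) proof (cases rule: subset_mset_add_msetE)
    case 1
    then show False using assms(3) U(2-) sub unfolding avoids_def
      by (meson subset_mset.order_trans)
  next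
    case (2 U')
    have oU': "over U'" using 2(2) sub assms(2) over_subset by (meson subset_mset.order_trans)
    have "U' + T \<subseteq># R" using 2(2) assms(4)
      by (metis subset_mset.le_diff_conv2 union_commute)
    moreover have "U' + T \<noteq> {#}" using assms(5) by simp
    moreover have "sG (U' + T) = \<one>\<^bsub>G\<^esub>"
      using U(3) oU' oT assms(7) 2(1) by (simp add: G.m_comm)
    moreover have "sH (U' + T) = l \<otimes>\<^bsub>H\<^esub> sH U"
      using oU' oT assms(7,8) 2(1) subgroup.mem_carrier[OF assms(1,6)] by (simp add: H.m_ac)
    then have "sH (U' + T) \<in> L" using U(4) assms(1,6) by (simp add: subgroup.m_closed)
    ultimately show False using assms(3) unfolding avoids_def by blast
  qed
qed

lemma seq_sum_in_subgroup:
  assumes "subgroup L H" "set_mset X \<subseteq> L"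
  shows "seq_sum H X \<in> L"
  using assms(2)
proof (induction X)
  case (add x X)
  moreover have "set_mset X \<subseteq> carrier H" "x \<in> carrier H"
    using add.prems subgroup.subset[OF assms(1)] by auto
  ultimately show ?case using assms(1) by (simp add: subgroup.m_closed)
qed (simp add: subgroup.one_closed[OF assms(1)])

text \<open>All H-components stay in \<open>L\<close>, so a vanishing subsum of the G-components
  would violate \<open>avoids\<close>. Passing to the G-components does not decrease the weight of
  any term.\<close>

lemma cross_le_of_projection:
  assumes "subgroup L H" "over R" "avoids L R" "\<And>z. z \<in># R \<Longrightarrow> fst z \<in> L"
  shows "cross_number K R \<le> little_cross G"
proof -
  have "zero_sum_free G (image_mset snd R)"
    unfolding zero_sum_free_def
  proof (intro allI impI notI)
    fix T assume T: "T \<subseteq># image_mset snd R \<and> T \<noteq> {#}" "seq_sum G T = \<one>\<^bsub>G\<^esub>"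
    then obtain U where U: "U \<subseteq># R" "T = image_mset snd U" by (auto elim: subset_mset_image_msetE)
    have "sH U \<in> L" unfolding sH_def using assms(4) U(1)
      by (intro seq_sum_in_subgroup[OF assms(1)]) (auto dest: mset_subset_eqD)
    then show False using assms(3) U T unfolding avoids_def sG_def by auto
  qed
  then have "cross_number G (image_mset snd R) \<le> little_cross G"
    using over_snd[OF assms(2)] by (intro G.cross_number_le_little_cross)
  moreover have "cross_number G (image_mset snd R) = (\<Sum>z\<in>#R. 1 / real (G.ord (snd z)))"
    using G.cross_number_eq[OF over_snd[OF assms(2)]] by (simp add: image_mset.compositionality o_def)
  moreover have "(\<Sum>z\<in>#R. weight z) \<le> (\<Sum>z\<in>#R. 1 / real (G.ord (snd z)))"
  proof (rule sum_mset_mono_real)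
    fix z assume "z \<in># R"
    then have "fst z \<in> carrier H" "snd z \<in> carrier G" using assms(2) by (auto simp: over_def)
    then have "H.ord (fst z) > 0" "G.ord (snd z) > 0" by (auto simp: H.ord_pos G.ord_pos)
    then show "weight z \<le> 1 / real (G.ord (snd z))" by (simp add: field_simps)
  qed
  ultimately show ?thesis using cross_K[OF assms(2)] by linarith
qed

lemma sum_seq_additive:
  fixes \<theta> :: "'h \<Rightarrow> int"
  assumes "subgroup H' H"
    and "\<And>x y. x \<in> H' \<Longrightarrow> y \<in> H' \<Longrightarrow> int p dvd \<theta> x + \<theta> y - \<theta> (x \<otimes>\<^bsub>H\<^esub> y)"
    and "set_mset X \<subseteq> H'"
  shows "int p dvd (\<Sum>x\<in>#X. \<theta> x) - \<theta> (seq_sum H X)"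
  using assms(3)
proof (induction X)
  case empty
  then show ?case using assms(2)[of "\<one>\<^bsub>H\<^esub>" "\<one>\<^bsub>H\<^esub>"] subgroup.one_closed[OF assms(1)] by simp
next
  case (add x X)
  have "set_mset X \<subseteq> carrier H" "x \<in> carrier H"
    using add.prems subgroup.subset[OF assms(1)] by auto
  moreover have "int p dvd \<theta> x + \<theta> (seq_sum H X) - \<theta> (x \<otimes>\<^bsub>H\<^esub> seq_sum H X)"
    using add.prems by (intro assms(2) seq_sum_in_subgroup[OF assms(1)]) auto
  moreover have "int p dvd (\<Sum>x\<in>#X. \<theta> x) - \<theta> (seq_sum H X)" using add by simp
  ultimately show ?case
    using dvd_add[of "int p" "\<theta> x + \<theta> (seq_sum H X) - \<theta> (x \<otimes>\<^bsub>H\<^esub> seq_sum H X)" "(\<Sum>x\<in>#X. \<theta> x) - \<theta> (seq_sum H X)"]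
    by (simp add: algebra_simps)
qed

text \<open>If the quotient of \<open>H'\<close> by \<open>L\<close> embeds in the cyclic group of order \<open>p\<close>, then any \<open>p\<close> terms
  outside \<open>L\<close> whose second components have the same order contain a block with sum in \<open>L\<close>. Replacing
  such blocks by their sums, fewer than \<open>p\<close> terms outside \<open>L\<close> survive for every order.\<close>

lemma cross_le_of_index_p:
  fixes \<theta> :: "'h \<Rightarrow> int" and q :: nat
  assumes "subgroup H' H"
    and \<theta>: "\<And>x y. x \<in> H' \<Longrightarrow> y \<in> H' \<Longrightarrow> int p dvd \<theta> x + \<theta> y - \<theta> (x \<otimes>\<^bsub>H\<^esub> y)"
    and L: "L = {x \<in> H'. int p dvd \<theta> x}" "subgroup L H"
    and q: "\<And>x. x \<in> H' \<Longrightarrow> x \<notin> L \<Longrightarrow> H.ord x = q" "q \<ge> p"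
    and "over R" "avoids L R" "\<And>z. z \<in># R \<Longrightarrow> fst z \<in> H'"
    and "\<And>z. z \<in># R \<Longrightarrow> fst z \<notin> L \<Longrightarrow> snd z \<noteq> \<one>\<^bsub>G\<^esub>"
  shows "cross_number K R \<le> little_cross G + (real p - 1) / real q * E"
  using assms(7-)
proof (induction "size {#z \<in># R. fst z \<notin> L#}" arbitrary: R rule: less_induct)
  case less
  let ?D = "G.ord ` (carrier G - {\<one>\<^bsub>G\<^esub>})"
  let ?B = "\<lambda>d. {#z \<in># R. fst z \<notin> L \<and> G.ord (snd z) = d#}"
  have q0: "q > 0" using q(2) p_gt_1 by simp
  show ?case
  proof (cases "\<exists>d. size (?B d) \<ge> p")
    case False
    \<comment> \<open>No order is crowded: the terms inside \<open>L\<close> project to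
      \<open>G\<close>, and outside \<open>L\<close> at most p - 1 terms of weight 1/(q d) remain
      for every d.\<close>
    define RL where "RL = {#z \<in># R. fst z \<in> L#}"
    define RN where "RN = {#z \<in># R. fst z \<notin> L#}"
    have R: "R = RL + RN" by (simp add: RL_def RN_def)
    have "over RL" "over RN" using less.prems(1) R by auto
    have 1: "cross_number K RL \<le> little_cross G"
    proof (rule cross_le_of_projection[OF L(2) \<open>over RL\<close>])
      show "avoids L RL" by (rule avoids_subset[OF less.prems(2)]) (simp add: RL_def)
    qed (simp add: RL_def)
    have "cross_number K RN = (\<Sum>z\<in>#RN. (1 / real q) * (1 / real (G.ord (snd z))))"
      unfolding cross_K[OF \<open>over RN\<close>]
      using less.prems(3) q(1) by (intro arg_cong[of _ _ sum_mset] image_mset_cong) (auto simp: RN_def)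
    also have "\<dots> \<le> (\<Sum>d\<in>?D. (real p - 1) * ((1 / real q) * (1 / real d)))"
    proof (rule sum_mset_key_le)
      fix z assume "z \<in># RN"
      then show "G.ord (snd z) \<in> ?D" using less.prems by (auto simp: RN_def over_def)
    next
      fix d
      have "{#z \<in># RN. G.ord (snd z) = d#} = ?B d" by (simp add: RN_def filter_filter_mset conj_commute)
      moreover have "size (?B d) < p" using False by (auto simp: not_le)
      ultimately show "real (size {#z \<in># RN. G.ord (snd z) = d#}) \<le> real p - 1" by simp
    qed (auto simp: G.fin)
    also have "\<dots> = (real p - 1) / real q * E"
      by (simp add: E_def sum_distrib_left)
    finally have 2: "cross_number K RN \<le> (real p - 1) / real q * E" .
    have "cross_number K R = cross_number K RL + cross_number K RN"
    proof -
      have "cross_number K (RL + RN) = cross_number K RL + cross_number K RN"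
        using \<open>over RL\<close> \<open>over RN\<close> by (simp add: cross_K)
      then show ?thesis using R by simp
    qed
    then show ?thesis using 1 2 by simp
  next
    case True
    then obtain d where "size (?B d) \<ge> p" by blast
    then obtain T where T: "T \<subseteq># ?B d" "T \<noteq> {#}" "size T \<le> p" "int p dvd (\<Sum>z\<in>#T. \<theta> (fst z))"
      using cyclic_zero_sum[OF p, of "?B d" "\<lambda>z. \<theta> (fst z)"] by blast
    have TR: "T \<subseteq># R" using T(1) multiset_filter_subset subset_mset.order_trans by blast
    have Tz: "z \<in># R \<and> fst z \<notin> L \<and> G.ord (snd z) = d" if "z \<in># T" for z
      using mset_subset_eqD[OF T(1) that] by simp
    have oT: "over T" using over_subset less.prems(1) TR by blast
    have TH: "set_mset (image_mset fst T) \<subseteq> H'"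
      unfolding set_image_mset using Tz less.prems(3) by blast
    have "int p dvd (\<Sum>x\<in>#image_mset fst T. \<theta> x) - \<theta> (sH T)"
      unfolding sH_def by (rule sum_seq_additive[OF assms(1) \<theta> TH])
    then have "int p dvd \<theta> (sH T)"
      using T(4) by (simp add: image_mset.compositionality o_def dvd_diff_right_iff)
    then have lL: "sH T \<in> L" using L(1) seq_sum_in_subgroup[OF assms(1) TH] by (simp add: sH_def)
    \<comment> \<open>The H-component of the block lies in \<open>L\<close>, hence may be reset to
      the identity. This removes its contribution to the order and makes the new term
      heavier.\<close>
    let ?t = "(\<one>\<^bsub>H\<^esub>, sG T)"
    let ?R = "add_mset ?t (R - T)"
    have oRT: "over (R - T)" using over_subset less.prems(1) by (meson diff_subset_eq_self)
    then have oR': "over ?R" using oT by simp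
    have av: "avoids L ?R"
      using oT by (intro avoids_amalgamate[OF L(2) less.prems(1,2) TR T(2) lL]) auto
    have oneL: "\<one>\<^bsub>H\<^esub> \<in> L" using L(2) subgroup.one_closed by blast
    have RT: "R = (R - T) + T" using TR by simp
    have "{#z \<in># R. fst z \<notin> L#} = {#z \<in># R - T. fst z \<notin> L#} + {#z \<in># T. fst z \<notin> L#}"
      by (subst RT) (rule filter_union_mset)
    moreover have "{#z \<in># T. fst z \<notin> L#} = T" using Tz by (simp add: filter_mset_eq_conv)
    ultimately have "size {#z \<in># R. fst z \<notin> L#} = size {#z \<in># R - T. fst z \<notin> L#} + size T"
      by (metis size_union)
    then have lt: "size {#z \<in># ?R. fst z \<notin> L#} < size {#z \<in># R. fst z \<notin> L#}"
      using T(2) oneL by (simp add: nonempty_has_size)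
    have "cross_number K ?R \<le> little_cross G + (real p - 1) / real q * E"
    proof (rule less.hyps[OF lt oR' av])
      fix z assume "z \<in># ?R"
      then have "z = ?t \<or> z \<in># R" by (auto dest: in_diffD)
      then show "fst z \<in> H'"
        using less.prems(3)[of z] subgroup.one_closed[OF assms(1)] by auto
    next
      fix z assume "z \<in># ?R" "fst z \<notin> L"
      then have "z \<in># R" using oneL by (auto dest: in_diffD)
      then show "snd z \<noteq> \<one>\<^bsub>G\<^esub>"
        using less.prems(4) \<open>fst z \<notin> L\<close> by blast
    qed
    \<comment> \<open>At most p \<le> q terms of weight 1/(q d) are replaced by one term of weight
      at least 1/d.\<close>
    moreover have "cross_number K T \<le> weight ?t"
    proof -
      obtain z where "z \<in># T" using T(2) by auto
      then have "d > 0" using Tz[of z] oT G.ord_pos[of "snd z"] by (auto simp: over_def)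
      have "cross_number K T = (\<Sum>z\<in>#T. 1 / (real q * real d))"
        unfolding cross_K[OF oT]
        using Tz less.prems(3) q(1) by (intro arg_cong[of _ _ sum_mset] image_mset_cong) simp
      also have "\<dots> = real (size T) / (real q * real d)" by simp
      also have "\<dots> \<le> real q / (real q * real d)"
        using T(3) q(2) by (intro divide_right_mono) auto
      also have "\<dots> = 1 / real d" using q0 by simp
      also have "\<dots> \<le> 1 / real (G.ord (sG T))"
      proof -
        have "x [^]\<^bsub>G\<^esub> d = \<one>\<^bsub>G\<^esub>" if x: "x \<in># image_mset snd T" for x
        proof -
          obtain z where "z \<in># T" "x = snd z" using x unfolding set_image_mset by blast
          then show ?thesis using Tz[of z] over_snd[OF oT] by (auto intro: G.pow_ord_eq_1)
        qed
        then have "sG T [^]\<^bsub>G\<^esub> d = \<one>\<^bsub>G\<^esub>" unfolding sG_def by (rule G.ord_seq_sum_dvd[OF over_snd[OF oT]])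
        then have "G.ord (sG T) \<le> d"
          using oT \<open>d > 0\<close> by (metis G.pow_eq_id dvd_imp_le sums_closed(2))
        then show ?thesis using G.ord_pos[of "sG T"] oT by (intro divide_left_mono) auto
      qed
      finally show ?thesis by simp
    qed
    moreover have "cross_number K ?R = weight ?t + cross_number K (R - T)"
      using cross_K[OF oR'] cross_K[OF oRT] by simp
    moreover have "cross_number K R = cross_number K (R - T) + cross_number K T"
    proof -
      have "cross_number K ((R - T) + T) = cross_number K (R - T) + cross_number K T"
        using oRT oT by (simp add: cross_K)
      then show ?thesis using RT by simp
    qed
    ultimately show ?thesis by linarith
  qed
qed

section \<open>Levels, extremal sequences and terms of high level\<close>

definition "level x = (SOME i. H.ord x = p ^ i)"

lemma level: "x \<in> carrier H \<Longrightarrow> H.ord x = p ^ level x"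
  unfolding level_def using ord_H by (rule someI_ex)

lemma pow_eq_one_iff_level:
  assumes "x \<in> carrier H"
  shows "x [^]\<^bsub>H\<^esub> (p ^ j) = \<one>\<^bsub>H\<^esub> \<longleftrightarrow> level x \<le> j"
proof -
  have "x [^]\<^bsub>H\<^esub> (p ^ j) = \<one>\<^bsub>H\<^esub> \<longleftrightarrow> p ^ level x dvd p ^ j"
    using H.pow_eq_id[OF assms] level[OF assms] by simp
  also have "\<dots> \<longleftrightarrow> level x \<le> j"
    using p_gt_1 by (metis le_imp_power_dvd power_dvd_imp_le)
  finally show ?thesis .
qed

text \<open>An extremal sequence of minimal length cannot be amalgamated without loss.\<close>

lemma extremal_few_of_order:
  assumes S: "over S" "zero_sum_free K S" "cross_number K S = little_cross K"
    and min: "\<And>S'. over S' \<Longrightarrow> zero_sum_free K S' \<Longrightarrow> cross_number K S' = little_cross K \<Longrightarrow> size S \<le> size S'"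
    and "i \<ge> 1"
  shows "size {#z \<in># S. level (fst z) = i \<and> G.ord (snd z) = d#} < 3 * p - 2"
proof (rule ccontr)
  let ?B = "{#z \<in># S. level (fst z) = i \<and> G.ord (snd z) = d#}"
  assume "\<not> ?thesis"
  then have large: "size (image_mset fst ?B) \<ge> 3 * p - 2" by simp
  have BS: "?B \<subseteq># S" by simp
  have oB: "over ?B" using over_subset S(1) BS by blast
  have "\<exists>X. X \<subseteq># image_mset fst ?B \<and> X \<noteq> {#} \<and> size X \<le> p \<and> seq_sum H X [^]\<^bsub>H\<^esub> (p ^ (i - 1)) = \<one>\<^bsub>H\<^esub>"
  proof (rule short[OF \<open>i \<ge> 1\<close> over_fst[OF oB] _ large])
    fix x assume "x \<in># image_mset fst ?B"
    then have "level x = i" "x \<in> carrier H" using S(1) by (auto simp: over_def)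
    then show "x [^]\<^bsub>H\<^esub> (p ^ i) = \<one>\<^bsub>H\<^esub>" by (simp add: pow_eq_one_iff_level)
  qed
  then obtain T where T: "T \<subseteq># ?B" "T \<noteq> {#}" "size T \<le> p" "sH T [^]\<^bsub>H\<^esub> (p ^ (i - 1)) = \<one>\<^bsub>H\<^esub>"
    unfolding sH_def by (auto elim!: subset_mset_image_msetE)
  have Tz: "z \<in># S \<and> level (fst z) = i \<and> G.ord (snd z) = d \<and> fst z \<in> carrier H \<and> snd z \<in> carrier G"
    if "z \<in># T" for z
    using mset_subset_eqD[OF T(1) that] S(1) by (auto simp: over_def)
  have TS: "T \<subseteq># S" using T(1) BS by (rule subset_mset.order_trans)
  have oT: "over T" using over_subset S(1) TS by blast
  have lev: "level (sH T) \<le> i - 1" using T(4) pow_eq_one_iff_level oT by simp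
  \<comment> \<open>A single term would keep level \<open>i\<close>, so the block has two terms and
    amalgamation really shortens the sequence.\<close>
  have size2: "size T \<ge> 2"
  proof (rule ccontr)
    assume "\<not> ?thesis"
    moreover have "size T \<noteq> 0" using T(2) by simp
    ultimately have "size T = 1" by linarith
    then obtain z where z: "T = {#z#}" by (metis size_1_singleton_mset)
    then have "sH T = fst z" "level (fst z) = i" using Tz[of z] by (auto simp: sH_def)
    then show False using lev \<open>i \<ge> 1\<close> by simp
  qed
  let ?t = "(sH T, sG T)"
  let ?S = "add_mset ?t (S - T)"
  have oST: "over (S - T)" using over_subset S(1) by (meson diff_subset_eq_self)
  then have oS': "over ?S" using oT by simp
  have "avoids {\<one>\<^bsub>H\<^esub>} ?S"
    using S(1,2) TS T(2) oT zero_sum_free_iff_avoids[OF S(1)] H.triv_subgroup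
    by (intro avoids_amalgamate[where l = "\<one>\<^bsub>H\<^esub>"]) auto
  then have zs: "zero_sum_free K ?S" using zero_sum_free_iff_avoids[OF oS'] by simp
  obtain z where "z \<in># T" using T(2) by auto
  then have "d > 0" using Tz[of z] G.ord_pos[of "snd z"] by simp
  \<comment> \<open>At most p terms of weight 1/(p^i d) weigh at most 1/(p^(i-1) d), and the order
    of the amalgamated term is at most p^(i-1) d.\<close>
  have "cross_number K T = (\<Sum>z\<in>#T. 1 / (real (p ^ i) * real d))"
    unfolding cross_K[OF oT]
    using Tz level by (intro arg_cong[of _ _ sum_mset] image_mset_cong) simp
  also have "\<dots> = real (size T) / (real (p ^ i) * real d)" by simp
  also have "\<dots> \<le> real p / (real (p ^ i) * real d)"
    using T(3) by (intro divide_right_mono) auto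
  also have "\<dots> = 1 / (real (p ^ (i - 1)) * real d)"
    using \<open>i \<ge> 1\<close> p_gt_1 by (cases i) auto
  also have "\<dots> \<le> weight ?t"
  proof -
    have "x [^]\<^bsub>G\<^esub> d = \<one>\<^bsub>G\<^esub>" if x: "x \<in># image_mset snd T" for x
    proof -
      obtain z where "z \<in># T" "x = snd z" using x unfolding set_image_mset by blast
      then show ?thesis using Tz[of z] by (auto intro: G.pow_ord_eq_1)
    qed
    then have "sG T [^]\<^bsub>G\<^esub> d = \<one>\<^bsub>G\<^esub>" unfolding sG_def by (rule G.ord_seq_sum_dvd[OF over_snd[OF oT]])
    then have "G.ord (sG T) \<le> d"
      using oT \<open>d > 0\<close> by (metis G.pow_eq_id dvd_imp_le sums_closed(2))
    moreover have "H.ord (sH T) \<le> p ^ (i - 1)"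
      using level[of "sH T"] oT lev p_gt_1 by simp
    moreover have "G.ord (sG T) > 0" "H.ord (sH T) > 0" using oT by (auto simp: G.ord_pos H.ord_pos)
    moreover from calculation have "H.ord (sH T) * G.ord (sG T) \<le> p ^ (i - 1) * d"
      by (intro mult_mono) auto
    then have "real (H.ord (sH T)) * real (G.ord (sG T)) \<le> real (p ^ (i - 1)) * real d"
      by (simp only: of_nat_le_iff flip: of_nat_mult)
    ultimately show ?thesis using p_gt_1 \<open>d > 0\<close>
      by (simp only: fst_conv snd_conv) (intro divide_left_mono mult_pos_pos, auto)
  qed
  finally have "cross_number K T \<le> weight ?t" .
  moreover have "cross_number K ?S = weight ?t + cross_number K (S - T)"
    using cross_K[OF oS'] cross_K[OF oST] by simp
  moreover have "cross_number K S = cross_number K (S - T) + cross_number K T"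
  proof -
    have "cross_number K ((S - T) + T) = cross_number K (S - T) + cross_number K T"
      using oST oT by (simp add: cross_K)
    then show ?thesis using TS by simp
  qed
  ultimately have "cross_number K S \<le> cross_number K ?S" by linarith
  moreover have "cross_number K ?S \<le> little_cross K"
    using oS' zs by (intro K.cross_number_le_little_cross) (auto simp: over_def)
  ultimately have "size S \<le> size ?S" using S(3) by (intro min oS' zs) simp
  also have "size ?S = size S - size T + 1" using TS by (simp add: size_Diff_submset)
  finally show False using size2 size_mset_mono[OF TS] by simp
qed

text \<open>At most 3(p - 1) terms of weight 1/(p^i d) occur for each level i > j and each order d.
  The geometric series over i absorbs the factor p - 1 and leaves 3/p^j; the sum over d gives
  \<open>E\<close>.\<close>

lemma cross_high_levels:
  assumes "over S" "\<And>i d. i \<ge> 1 \<Longrightarrow> size {#z \<in># S. level (fst z) = i \<and> G.ord (snd z) = d#} < 3 * p - 2"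
    and "R \<subseteq># S" "\<And>z. z \<in># R \<Longrightarrow> snd z \<noteq> \<one>\<^bsub>G\<^esub> \<and> level (fst z) > j"
  shows "cross_number K R \<le> 3 / real p ^ j * E"
proof -
  let ?D = "G.ord ` (carrier G - {\<one>\<^bsub>G\<^esub>})"
  define M where "M = Max (level ` carrier H)"
  have oR: "over R" using over_subset assms by blast
  have Rz: "fst z \<in> carrier H" "snd z \<in> carrier G" if "z \<in># R" for z
    using that oR by (auto simp: over_def)
  define w where "w = (\<lambda>(i, d). 1 / (real p ^ i * real d))"
  have "cross_number K R = (\<Sum>z\<in>#R. w (level (fst z), G.ord (snd z)))"
    unfolding cross_K[OF oR] w_def
    using Rz level by (intro arg_cong[of _ _ sum_mset] image_mset_cong) simp
  also have "\<dots> \<le> (\<Sum>k\<in>{j<..M} \<times> ?D. (3 * (real p - 1)) * w k)"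
  proof (rule sum_mset_key_le)
    fix z assume z: "z \<in># R"
    then have "level (fst z) \<le> M" unfolding M_def using Rz H.fin by auto
    then show "(level (fst z), G.ord (snd z)) \<in> {j<..M} \<times> ?D" using assms(4)[OF z] Rz[OF z] by auto
  next
    fix k assume "k \<in> {j<..M} \<times> ?D"
    then obtain i d where k: "k = (i, d)" "i > j" by auto
    have "{#z \<in># R. (level (fst z), G.ord (snd z)) = k#} \<subseteq># {#z \<in># S. level (fst z) = i \<and> G.ord (snd z) = d#}"
      unfolding k using multiset_filter_mono[OF assms(3)] by simp
    from size_mset_mono[OF this]
    have "size {#z \<in># R. (level (fst z), G.ord (snd z)) = k#} < 3 * p - 2"
      using assms(2)[of i d] k(2) by linarith
    then have "size {#z \<in># R. (level (fst z), G.ord (snd z)) = k#} + 3 \<le> 3 * p" by linarith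
    then have "real (size {#z \<in># R. (level (fst z), G.ord (snd z)) = k#} + 3) \<le> real (3 * p)"
      by (simp only: of_nat_le_iff)
    then show "real (size {#z \<in># R. (level (fst z), G.ord (snd z)) = k#}) \<le> 3 * (real p - 1)" by simp
  qed (auto simp: G.fin w_def)
  also have "\<dots> = 3 * ((real p - 1) * (\<Sum>i\<in>{j<..M}. 1 / real p ^ i)) * E"
  proof -
    have "(\<Sum>k\<in>{j<..M} \<times> ?D. w k) = (\<Sum>i\<in>{j<..M}. \<Sum>d\<in>?D. (1 / real p ^ i) * (1 / real d))"
      unfolding w_def by (simp add: sum.cartesian_product)
    also have "\<dots> = (\<Sum>i\<in>{j<..M}. 1 / real p ^ i) * E"
      unfolding E_def by (rule sum_product[symmetric])
    finally show ?thesis by (simp add: sum_distrib_left[symmetric])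
  qed
  also have "\<dots> \<le> 3 * (1 / real p ^ j) * E"
    using geometric_tail_le[of p j M] p_gt_1
    by (intro mult_right_mono mult_left_mono) (auto simp: E_def intro!: sum_nonneg)
  finally show ?thesis by simp
qed

lemma subgroup_of_exponent: "subgroup {x \<in> carrier H. x [^]\<^bsub>H\<^esub> (k::nat) = \<one>\<^bsub>H\<^esub>} H"
  by (rule H.subgroupI) (auto simp: H.pow_mult_distrib H.m_comm H.nat_pow_inv)

theorem little_cross_DirProd_le: "little_cross K \<le> W + little_cross G"
proof -
  let ?ext = "\<lambda>S. over S \<and> zero_sum_free K S \<and> cross_number K S = little_cross K"
  obtain S0 where "?ext S0"
    using K.little_cross_attained by (auto simp: over_def)
  then obtain S where ext: "?ext S" and min: "\<And>S'. ?ext S' \<Longrightarrow> size S \<le> size S'"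
    using ex_has_least_nat[of ?ext S0 size] by blast
  have oS: "over S" and zs: "zero_sum_free K S" and cS: "cross_number K S = little_cross K"
    using ext by auto
  have few: "size {#z \<in># S. level (fst z) = i \<and> G.ord (snd z) = d#} < 3 * p - 2" if "i \<ge> 1" for i d
    using extremal_few_of_order[OF oS zs cS] min that by blast
  \<comment> \<open>\<open>S1\<close> is the part of the sequence in \<open>H\<close>;
    \<open>Q\<close> below, later listed as \<open>P\<close>, collects its H-components.\<close>
  define S1 where "S1 = {#z \<in># S. snd z = \<one>\<^bsub>G\<^esub>#}"
  define N where "N = {#z \<in># S. snd z \<noteq> \<one>\<^bsub>G\<^esub>#}"
  have SS: "S = S1 + N" by (simp add: S1_def N_def)
  have oS1: "over S1" and oN: "over N" using oS SS by auto
  have avS: "avoids {\<one>\<^bsub>H\<^esub>} S" using zs zero_sum_free_iff_avoids[OF oS] by simp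
  have avS1: "avoids {\<one>\<^bsub>H\<^esub>} S1" using avS SS avoids_subset by (metis mset_subset_eq_add_left)
  define Q where "Q = image_mset fst S1"
  have Qc: "set_mset Q \<subseteq> carrier H" unfolding Q_def by (rule over_fst[OF oS1])
  have sG1: "sG U = \<one>\<^bsub>G\<^esub>" if "U \<subseteq># S1" for U
  proof -
    have "\<forall>z \<in># U. snd z = \<one>\<^bsub>G\<^esub>" using that by (auto simp: S1_def dest!: mset_subset_eqD)
    then have "image_mset snd U = replicate_mset (size U) \<one>\<^bsub>G\<^esub>" by (induction U) auto
    then show ?thesis by (simp add: sG_def G.seq_sum_replicate)
  qed
  have zQ: "zero_sum_free H Q"
    unfolding zero_sum_free_def
  proof (intro allI impI notI)
    fix T assume "T \<subseteq># Q \<and> T \<noteq> {#}" "seq_sum H T = \<one>\<^bsub>H\<^esub>"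
    then obtain U where "U \<subseteq># S1" "T = image_mset fst U" "U \<noteq> {#}" "sH U = \<one>\<^bsub>H\<^esub>"
      by (auto simp: Q_def sH_def elim!: subset_mset_image_msetE)
    then show False using avS1 sG1 unfolding avoids_def by auto
  qed
  have cross_S: "cross_number K S = cross_number H Q + cross_number K N"
  proof -
    have "cross_number K S1 = cross_number H Q"
      unfolding cross_K[OF oS1] H.cross_number_eq[OF Qc]
      by (auto simp: Q_def S1_def image_mset.compositionality o_def intro!: arg_cong[of _ _ sum_mset] image_mset_cong)
    moreover have "cross_number K (S1 + N) = cross_number K S1 + cross_number K N"
      using oS1 oN by (simp add: cross_K)
    ultimately show ?thesis using SS by simp
  qed
  define Cov where "Cov = {seq_sum H T | T. T \<subseteq># Q}"
  \<comment> \<open>If a block of \<open>N\<close> had its sum in \<open>L\<close>, the inverse of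
    that sum would be a subsum of \<open>Q\<close>, and the two blocks together would have sum zero
    in \<open>S\<close>.\<close>
  have avN: "avoids L N" if "subgroup L H" "L \<subseteq> Cov" for L
    unfolding avoids_def
  proof (intro allI impI notI)
    fix U assume U: "U \<subseteq># N" "U \<noteq> {#}" "sG U = \<one>\<^bsub>G\<^esub>" "sH U \<in> L"
    have oU: "over U" using over_subset oN U(1) by blast
    have "inv\<^bsub>H\<^esub> (sH U) \<in> Cov" using subgroup.m_inv_closed[OF that(1) U(4)] that(2) by blast
    then obtain T where T: "T \<subseteq># S1" "sH T = inv\<^bsub>H\<^esub> (sH U)"
      by (auto simp: Cov_def Q_def sH_def elim!: subset_mset_image_msetE)
    have oT: "over T" using over_subset oS1 T(1) by blast
    have "T + U \<subseteq># S" unfolding SS using T(1) U(1) by (rule subset_mset.add_mono)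
    moreover have "sG (T + U) = \<one>\<^bsub>G\<^esub>" using sG1[OF T(1)] U(3) oT oU by simp
    moreover have "sH (T + U) = \<one>\<^bsub>H\<^esub>" using T(2) oT oU by (simp add: H.l_inv)
    ultimately show False using avS U(2) unfolding avoids_def by auto
  qed
  have E1: "E \<le> 1 / (2 * real p + 1)" using reciprocal_sum by (simp add: E_def)
  have pr: "real p \<ge> 2" using p_gt_1 by simp
  show ?thesis
  proof (cases "Cov = carrier H")
    case True
    have "cross_number K N \<le> little_cross G"
      using avN[OF H.subgroup_self] True oN
      by (intro cross_le_of_projection[OF H.subgroup_self]) (auto simp: over_def)
    moreover have "cross_number H Q \<le> W" by (rule H.cross_number_le_olson[OF p olson Qc zQ])
    ultimately show ?thesis using cross_S cS by simp
  next
    case False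
    have "Cov \<subseteq> carrier H" using Qc by (auto simp: Cov_def intro!: H.seq_sum_closed dest: set_mset_mono)
    then have "\<exists>h. h \<in> carrier H - Cov" using False by auto
    then obtain h where h: "h \<in> carrier H - Cov" and hmin: "\<And>y. y \<in> carrier H - Cov \<Longrightarrow> H.ord h \<le> H.ord y"
      using ex_has_least_nat[of "\<lambda>h. h \<in> carrier H - Cov" _ H.ord] by blast
    have "\<one>\<^bsub>H\<^esub> \<in> Cov" unfolding Cov_def by (auto intro!: exI[of _ "{#}"])
    then have "h \<noteq> \<one>\<^bsub>H\<^esub>" using h by auto
    then have "level h \<noteq> 0" using level[of h] h H.ord_eq_1[of h] by (auto simp del: H.ord_eq_1)
    then obtain j where j: "level h = Suc j" using not0_implies_Suc by blast
    define u where "u = 1 / real p ^ Suc j"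
    \<comment> \<open>Orders in \<open>H\<close> are powers of p, so minimality of the order of
      \<open>h\<close> makes every element of H[p^j] a subsum.\<close>
    have covered: "x \<in> Cov" if "x \<in> carrier H" "level x \<le> j" for x
    proof (rule ccontr)
      assume "x \<notin> Cov"
      then have "p ^ level h \<le> p ^ level x" using hmin[of x] that h level by auto
      then have "level h \<le> level x" using power_le_imp_le_exp p_gt_1 by blast
      then show False using j that by simp
    qed
    show ?thesis
    proof (cases "cross_number H Q + 2 * u \<le> W")
      case True
      define L where "L = {x \<in> carrier H. x [^]\<^bsub>H\<^esub> (p ^ j) = \<one>\<^bsub>H\<^esub>}"
      have subL: "subgroup L H" unfolding L_def by (rule subgroup_of_exponent)
      have LC: "L \<subseteq> Cov" using covered by (auto simp: L_def pow_eq_one_iff_level)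
      define N1 where "N1 = {#z \<in># N. fst z \<in> L#}"
      define N2 where "N2 = {#z \<in># N. fst z \<notin> L#}"
      have NN: "N = N1 + N2" by (simp add: N1_def N2_def)
      have oN1: "over N1" and oN2: "over N2" using oN NN by auto
      have "cross_number K N1 \<le> little_cross G"
      proof (rule cross_le_of_projection[OF subL oN1])
        show "avoids L N1" by (rule avoids_subset[OF avN[OF subL LC]]) (simp add: N1_def)
      qed (simp add: N1_def)
      moreover have "cross_number K N2 \<le> 3 / real p ^ j * E"
      proof (rule cross_high_levels[OF oS few])
        show "N2 \<subseteq># S" using SS NN by (metis mset_subset_eq_add_right subset_mset.order_trans)
        fix z assume "z \<in># N2"
        then show "snd z \<noteq> \<one>\<^bsub>G\<^esub> \<and> j < level (fst z)"
          using oN2 by (auto simp: N2_def N_def L_def over_def pow_eq_one_iff_level)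
      qed
      moreover have "3 / real p ^ j * E \<le> 2 * u"
      proof -
        have "3 / real p ^ j * E \<le> 3 / real p ^ j * (1 / (2 * real p + 1))"
          using E1 by (intro mult_left_mono) auto
        also have "\<dots> = 3 / (2 * real p + 1) * (1 / real p ^ j)" by simp
        \<comment> \<open>This amounts to 3p \<le> 4p + 2.\<close>
        also have "\<dots> \<le> 2 / real p * (1 / real p ^ j)"
          using pr by (intro mult_right_mono) (auto simp: field_simps)
        also have "\<dots> = 2 * u" by (simp add: u_def)
        finally show ?thesis .
      qed
      moreover have "cross_number K N = cross_number K N1 + cross_number K N2"
      proof -
        have "cross_number K (N1 + N2) = cross_number K N1 + cross_number K N2"
          using oN1 oN2 by (simp add: cross_K)
        then show ?thesis using NN by simp
      qed
      ultimately show ?thesis using cross_S cS True by linarith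
    next
      case heavy: False
      obtain P where P: "mset P = Q" using ex_mset by blast
      then have Pc: "set P \<subseteq> carrier H" using Qc by auto
      have crossP: "(\<Sum>g\<leftarrow>P. 1 / real (H.ord g)) = cross_number H Q"
        using H.cross_number_eq[OF Qc] P by (metis mset_map sum_mset_sum_list)
      define H' where "H' = {x \<in> carrier H. x [^]\<^bsub>H\<^esub> (p ^ Suc j) = \<one>\<^bsub>H\<^esub>}"
      have subH': "subgroup H' H" unfolding H'_def by (rule subgroup_of_exponent)
      have H'c: "x \<in> carrier H" if "x \<in> H'" for x using that by (simp add: H'_def)
      have uH': "1 / real (H.ord x) \<ge> u" if "x \<in> H'" for x
      proof -
        have "level x \<le> Suc j" using that pow_eq_one_iff_level[of x "Suc j"] by (simp add: H'_def del: power_Suc)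
        then have "real p ^ level x \<le> real p ^ Suc j" using p_gt_1 by (intro power_increasing) auto
        then show ?thesis using level[OF H'c[OF that]] p_gt_1 by (simp add: u_def divide_left_mono)
      qed
      \<comment> \<open>With D = \<open>diff_op H f P\<close>, this is D(1) - D(x). The second
        difference of D by x and y at the identity is then \<theta>(x) + \<theta>(y) -
        \<theta>(xy).\<close>
      define \<theta> where "\<theta> x = diff_op H f (x # P) \<one>\<^bsub>H\<^esub>" for x
      have vanish: "int p dvd diff_op H f X \<one>\<^bsub>H\<^esub>"
        if "set X \<subseteq> carrier H" "W < (\<Sum>g\<leftarrow>X. 1 / real (H.ord g))" for X
        using olson that unfolding olson_fun_def by simp
      have add: "int p dvd \<theta> x + \<theta> y - \<theta> (x \<otimes>\<^bsub>H\<^esub> y)" if xy: "x \<in> H'" "y \<in> H'" for x y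
      proof -
        \<comment> \<open>Both \<open>x\<close> and \<open>y\<close> weigh at least
          \<open>u\<close>, and \<open>P\<close> weighs more than W - 2u.\<close>
        have "int p dvd diff_op H f (x # y # P) \<one>\<^bsub>H\<^esub>"
          using xy H'c Pc uH'[of x] uH'[of y] heavy crossP by (intro vanish) auto
        then show ?thesis using xy H'c by (simp add: \<theta>_def algebra_simps)
      qed
      define L where "L = {x \<in> H'. int p dvd \<theta> x}"
      have one: "int p dvd \<theta> \<one>\<^bsub>H\<^esub>" by (simp add: \<theta>_def)
      have subL: "subgroup L H"
      proof (rule H.subgroupI)
        show "L \<subseteq> carrier H" using H'c by (auto simp: L_def)
        show "L \<noteq> {}" using one subgroup.one_closed[OF subH'] by (auto simp: L_def)
      next
        fix a assume a: "a \<in> L"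
        then have a': "a \<in> H'" "inv\<^bsub>H\<^esub> a \<in> H'" using subH' by (auto simp: L_def subgroup.m_inv_closed)
        have "int p dvd \<theta> a + \<theta> (inv\<^bsub>H\<^esub> a) - \<theta> \<one>\<^bsub>H\<^esub>" using add[OF a'] H'c[OF a'(1)] by (simp add: H.r_inv)
        then have "int p dvd \<theta> (inv\<^bsub>H\<^esub> a)" using a one
          by (simp add: L_def dvd_diff_left_iff dvd_add_right_iff)
        then show "inv\<^bsub>H\<^esub> a \<in> L" using a' by (simp add: L_def)
      next
        fix a b assume ab: "a \<in> L" "b \<in> L"
        then have ab': "a \<in> H'" "b \<in> H'" by (auto simp: L_def)
        have "int p dvd \<theta> a + \<theta> b" using ab by (simp add: L_def)
        then have "int p dvd \<theta> (a \<otimes>\<^bsub>H\<^esub> b)" using add[OF ab'] by (simp add: dvd_diff_right_iff)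
        then show "a \<otimes>\<^bsub>H\<^esub> b \<in> L" using ab' subH' by (simp add: L_def subgroup.m_closed)
      qed
      \<comment> \<open>An element of level at most j weighs at least 1/p^j \<ge> 2u, so it alone
        pushes the weight above \<open>W\<close> and \<theta> vanishes on it.\<close>
      have not_in_L: "level x = Suc j" if x: "x \<in> H'" "x \<notin> L" for x
      proof (rule ccontr)
        assume "level x \<noteq> Suc j"
        moreover have "level x \<le> Suc j" using x(1) pow_eq_one_iff_level[of x "Suc j"] by (simp add: H'_def del: power_Suc)
        ultimately have "real p ^ level x \<le> real p ^ j" using p_gt_1 by (intro power_increasing) auto
        then have "1 / real p ^ j \<le> 1 / real (H.ord x)"
          using level[OF H'c[OF x(1)]] p_gt_1 by (simp add: divide_left_mono)
        moreover have "2 * u \<le> 1 / real p ^ j" using pr by (simp add: u_def field_simps)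
        ultimately have "int p dvd \<theta> x"
          unfolding \<theta>_def using x H'c Pc heavy crossP by (intro vanish) auto
        then show False using x by (simp add: L_def)
      qed
      \<comment> \<open>If \<open>x\<close> together with \<open>P\<close> were zero-sum free,
        \<theta>(x) would be 1 modulo p. So some vanishing subsum uses \<open>x\<close>, and the
        rest of it sums to the inverse of \<open>x\<close>.\<close>
      have "inv\<^bsub>H\<^esub> x \<in> Cov" if x: "x \<in> L" for x
      proof -
        have xc: "x \<in> carrier H" using x H'c by (simp add: L_def)
        have "\<not> zero_sum_free H (mset (x # P))"
          using H.not_dvd_diff_op_of_zero_sum_free[OF p olson, of "x # P"] x xc Pc
          by (auto simp: L_def \<theta>_def)
        then obtain T where T: "T \<subseteq># add_mset x Q" "T \<noteq> {#}" "seq_sum H T = \<one>\<^bsub>H\<^esub>"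
          using P unfolding zero_sum_free_def by auto
        from T(1) show ?thesis
        proof (cases rule: subset_mset_add_msetE)
          case 1
          then show ?thesis using T zQ unfolding zero_sum_free_def by blast
        next
          case (2 T')
          have T'c: "set_mset T' \<subseteq> carrier H" using H.seq_over_subset[OF Qc 2(2)] .
          then have "x \<otimes>\<^bsub>H\<^esub> seq_sum H T' = \<one>\<^bsub>H\<^esub>" using T(3) 2(1) xc by simp
          then have "inv\<^bsub>H\<^esub> x = seq_sum H T'"
            using xc T'c H.seq_sum_closed[OF T'c] by (metis H.inv_equality H.m_comm)
          then show ?thesis using 2(2) by (auto simp: Cov_def)
        qed
      qed
      then have LC: "L \<subseteq> Cov"
        using subgroup.m_inv_closed[OF subL] subgroup.mem_carrier[OF subL] H.inv_inv by (metis subsetI)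
      \<comment> \<open>\<open>N1\<close> is handled modulo \<open>L\<close>, since elements of
        \<open>H'\<close> outside \<open>L\<close> have order exactly p^(j+1); \<open>N2\<close>
        consists of terms of level above j + 1.\<close>
      define N1 where "N1 = {#z \<in># N. fst z \<in> H'#}"
      define N2 where "N2 = {#z \<in># N. fst z \<notin> H'#}"
      have NN: "N = N1 + N2" by (simp add: N1_def N2_def)
      have oN1: "over N1" and oN2: "over N2" using oN NN by auto
      have "cross_number K N1 \<le> little_cross G + (real p - 1) / real (p ^ Suc j) * E"
      proof (rule cross_le_of_index_p[OF subH' add L_def subL])
        show "avoids L N1" by (rule avoids_subset[OF avN[OF subL LC]]) (simp add: N1_def)
        show "H.ord x = p ^ Suc j" if "x \<in> H'" "x \<notin> L" for x
          using not_in_L[OF that] level[OF H'c[OF that(1)]] by simp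
        show "p \<le> p ^ Suc j" using p_gt_1 by simp
      qed (use oN1 in \<open>auto simp: N1_def N_def\<close>)
      moreover have "cross_number K N2 \<le> 3 / real p ^ Suc j * E"
      proof (rule cross_high_levels[OF oS few])
        show "N2 \<subseteq># S" using SS NN by (metis mset_subset_eq_add_right subset_mset.order_trans)
        fix z assume "z \<in># N2"
        then show "snd z \<noteq> \<one>\<^bsub>G\<^esub> \<and> Suc j < level (fst z)"
          using oN2 pow_eq_one_iff_level[of "fst z" "Suc j"] by (auto simp: N2_def N_def H'_def over_def simp del: power_Suc)
      qed
      moreover have "(real p - 1) / real (p ^ Suc j) * E + 3 / real p ^ Suc j * E \<le> u"
      proof -
        have "(real p - 1) / real (p ^ Suc j) * E + 3 / real p ^ Suc j * E = (real p + 2) * u * E"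
          by (simp add: u_def add_divide_distrib diff_divide_distrib algebra_simps)
        also have "\<dots> \<le> (real p + 2) * u * (1 / (2 * real p + 1))"
          using E1 by (intro mult_left_mono) (auto simp: u_def)
        also have "\<dots> = u * ((real p + 2) / (2 * real p + 1))" by simp
        \<comment> \<open>The coefficients p - 1 and 3 add up to p + 2 \<le> 2p + 1.\<close>
        also have "\<dots> \<le> u * 1" using pr by (intro mult_left_mono) (auto simp: u_def)
        finally show ?thesis by simp
      qed
      moreover have "cross_number K N = cross_number K N1 + cross_number K N2"
      proof -
        have "cross_number K (N1 + N2) = cross_number K N1 + cross_number K N2"
          using oN1 oN2 by (simp add: cross_K)
        then show ?thesis using NN by simp
      qed
      moreover have "cross_number H Q + u \<le> W"
      proof -
        let ?h = "inv\<^bsub>H\<^esub> h"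
        have hc: "h \<in> carrier H" using h by simp
        \<comment> \<open>A vanishing subsum using the inverse of \<open>h\<close> would exhibit
          \<open>h\<close> as a subsum of \<open>Q\<close>.\<close>
        have "zero_sum_free H (add_mset ?h Q)"
          unfolding zero_sum_free_def
        proof (intro allI impI notI)
          fix T assume T: "T \<subseteq># add_mset ?h Q \<and> T \<noteq> {#}" "seq_sum H T = \<one>\<^bsub>H\<^esub>"
          then have "T \<subseteq># add_mset ?h Q" by simp
          then show False
          proof (cases rule: subset_mset_add_msetE)
            case 1
            then show ?thesis using T zQ unfolding zero_sum_free_def by blast
          next
            case (2 T')
            have T'c: "set_mset T' \<subseteq> carrier H" using H.seq_over_subset[OF Qc 2(2)] .
            then have "?h \<otimes>\<^bsub>H\<^esub> seq_sum H T' = \<one>\<^bsub>H\<^esub>" using T(2) 2(1) hc by simp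
            then have "h = seq_sum H T'"
              using hc T'c H.seq_sum_closed[OF T'c] by (metis H.inv_closed H.inv_equality H.inv_inv H.m_comm)
            then show False using 2(2) h by (auto simp: Cov_def)
          qed
        qed
        then have "cross_number H (add_mset ?h Q) \<le> W"
          using Qc hc by (intro H.cross_number_le_olson[OF p olson]) auto
        moreover have "cross_number H (add_mset ?h Q) = u + cross_number H Q"
          using Qc hc level[OF hc] j by (simp add: H.cross_number_eq u_def)
        ultimately show ?thesis by simp
      qed
      ultimately show ?thesis using cross_S cS by linarith
    qed
  qed
qed

end

section \<open>Invariance of k-star\<close>

definition prime_power_decomposition ::
  "('a, 'b) monoid_scheme \<Rightarrow> nat \<Rightarrow> (nat \<Rightarrow> nat) \<Rightarrow> (nat \<Rightarrow> nat) \<Rightarrow> bool" where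
  "prime_power_decomposition G r q a \<longleftrightarrow> (\<forall>i<r. Factorial_Ring.prime (q i) \<and> a i \<ge> 1) \<and>
     G \<cong> product_group {..<r} (\<lambda>i. integer_mod_group (q i ^ a i))"

text \<open>Being invariant under isomorphism and multiplicative over direct products, this number
  can be computed from any decomposition.\<close>

definition torsion_card :: "('a, 'b) monoid_scheme \<Rightarrow> nat \<Rightarrow> nat" where
  "torsion_card G k = card {x \<in> carrier G. x [^]\<^bsub>G\<^esub> k = \<one>\<^bsub>G\<^esub>}"

lemma torsion_card_iso:
  assumes "group A" "group B" "A \<cong> B"
  shows "torsion_card A k = torsion_card B k"
proof -
  interpret A: group A by fact
  interpret B: group B by fact
  obtain h where h: "h \<in> iso A B" using assms(3) by (auto simp: is_iso_def)
  then interpret group_hom A B h by unfold_locales (auto simp: iso_def)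
  have bij: "bij_betw h (carrier A) (carrier B)" using h by (simp add: iso_def)
  then have inj: "inj_on h (carrier A)" by (rule bij_betw_imp_inj_on)
  have eq: "h x [^]\<^bsub>B\<^esub> k = \<one>\<^bsub>B\<^esub> \<longleftrightarrow> x [^]\<^bsub>A\<^esub> k = \<one>\<^bsub>A\<^esub>" if "x \<in> carrier A" for x
    using that inj by (metis A.nat_pow_closed A.one_closed hom_nat_pow hom_one inj_onD)
  have "bij_betw h {x \<in> carrier A. x [^]\<^bsub>A\<^esub> k = \<one>\<^bsub>A\<^esub>} {x \<in> carrier B. x [^]\<^bsub>B\<^esub> k = \<one>\<^bsub>B\<^esub>}"
    using bij eq unfolding bij_betw_def by (auto simp: inj_on_def image_iff) (metis imageE)
  then show ?thesis unfolding torsion_card_def by (rule bij_betw_same_card)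
qed

lemma pow_product_group:
  assumes "f \<in> carrier (product_group I X)" "\<And>i. i \<in> I \<Longrightarrow> group (X i)"
  shows "f [^]\<^bsub>product_group I X\<^esub> (k::nat) = (\<lambda>i\<in>I. f i [^]\<^bsub>X i\<^esub> k)"
  by (induction k) (auto intro!: restrict_ext)

lemma torsion_card_product_group:
  assumes "finite I" "\<And>i. i \<in> I \<Longrightarrow> group (X i)"
  shows "torsion_card (product_group I X) k = (\<Prod>i\<in>I. torsion_card (X i) k)"
proof -
  have "{f \<in> carrier (product_group I X). f [^]\<^bsub>product_group I X\<^esub> k = \<one>\<^bsub>product_group I X\<^esub>}
    = (\<Pi>\<^sub>E i\<in>I. {x \<in> carrier (X i). x [^]\<^bsub>X i\<^esub> k = \<one>\<^bsub>X i\<^esub>})" (is "?L = ?R")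
  proof (intro Set.set_eqI iffI)
    fix f assume f: "f \<in> ?L"
    then have fc: "f \<in> carrier (product_group I X)" by blast
    have eq: "(\<lambda>i\<in>I. f i [^]\<^bsub>X i\<^esub> k) = (\<lambda>i\<in>I. \<one>\<^bsub>X i\<^esub>)"
      using f pow_product_group[OF fc assms(2), of k] by simp
    have "f i [^]\<^bsub>X i\<^esub> k = \<one>\<^bsub>X i\<^esub>" if "i \<in> I" for i using that fun_cong[OF eq, of i] by simp
    then show "f \<in> ?R" using fc by (auto simp: PiE_iff)
  next
    fix f assume f: "f \<in> ?R"
    then have fc: "f \<in> carrier (product_group I X)" by (auto simp: PiE_iff)
    then show "f \<in> ?L" using f pow_product_group[OF fc assms(2), of k]
      by (auto simp: PiE_iff intro!: restrict_ext)
  qed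
  then show ?thesis unfolding torsion_card_def by (simp add: card_PiE assms(1))
qed

text \<open>The solutions of k x = 0 modulo n are the multiples of n / gcd(n, k).\<close>

lemma torsion_card_cyclic:
  assumes "n > 0" "k > 0"
  shows "torsion_card (integer_mod_group n) k = gcd n k"
proof -
  define g where "g = gcd n k"
  define n' where "n' = n div g"
  define k' where "k' = k div g"
  have g: "g > 0" "n = g * n'" "k = g * k'" using assms by (auto simp: g_def n'_def k'_def)
  have cop: "coprime n' k'" using assms unfolding n'_def k'_def g_def by (intro div_gcd_coprime) auto
  have n': "n' > 0" using g assms by (metis gr0I mult_0_right)
  have "{x \<in> carrier (integer_mod_group n). x [^]\<^bsub>integer_mod_group n\<^esub> k = \<one>\<^bsub>integer_mod_group n\<^esub>}
     = (\<lambda>j. int (n' * j)) ` {..<g}" (is "?L = ?R")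
  proof (intro Set.set_eqI iffI)
    fix x assume x: "x \<in> ?L"
    then have xb: "0 \<le> x" "x < int n" using assms by (auto simp: carrier_integer_mod_group)
    have "int n dvd int k * x" using x by (auto simp: mod_eq_0_iff_dvd)
    then have "int g * int n' dvd int g * (int k' * x)" using g by (simp add: mult.assoc)
    then have "int n' dvd int k' * x" using g by simp
    then have "int n' dvd x" using cop by (metis coprime_dvd_mult_right_iff coprime_int_iff)
    then obtain c where c: "x = int n' * c" by blast
    have "c \<ge> 0" using c xb n' by (simp add: zero_le_mult_iff)
    moreover have "c < int g" using c xb g n' by (simp add: mult.commute)
    ultimately show "x \<in> ?R" using c by (intro image_eqI[of _ _ "nat c"]) auto
  next
    fix x assume "x \<in> ?R"
    then obtain j where j: "j < g" "x = int (n' * j)" by auto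
    have "int k * x = int n * int (k' * j)" using g j by simp
    then have "int n dvd int k * x" by (metis dvd_triv_left)
    moreover have "x < int n" using j g n' by simp
    moreover have "x \<ge> 0" using j by simp
    ultimately show "x \<in> ?L" using assms by (simp add: carrier_integer_mod_group)
  qed
  moreover have "inj_on (\<lambda>j. int (n' * j)) {..<g}" using n' by (auto simp: inj_on_def)
  ultimately show ?thesis unfolding torsion_card_def by (simp add: card_image g_def)
qed

lemma gcd_prime_powers:
  fixes p q a k :: nat
  assumes "Factorial_Ring.prime p" "Factorial_Ring.prime q"
  shows "gcd (q ^ a) (p ^ k) = (if q = p then p ^ min a k else 1)"
proof (cases "q = p")
  case True
  then show ?thesis
    by (cases "a \<le> k") (auto simp: min_def gcd_proj1_iff gcd_proj2_iff le_imp_power_dvd gcd.commute)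
next
  case False
  then have "coprime (q ^ a) (p ^ k)" using primes_coprime[OF assms(2,1)] by simp
  then show ?thesis using False by simp
qed

text \<open>For a cyclic group of order \<open>p ^ a\<close> the \<open>p\<close>-adic valuations of the numbers of solutions of
  \<open>x ^ p ^ k = 1\<close> increase by one for \<open>k = 1, \<dots>, a\<close> and are constant afterwards, and
  \<open>1 - 1 / p ^ a\<close> is the sum of \<open>(p - 1) / p ^ k\<close> over these \<open>k\<close>.\<close>

definition torsion_invariant :: "('a, 'b) monoid_scheme \<Rightarrow> real" where
  "torsion_invariant G = (\<Sum>p | Factorial_Ring.prime p \<and> p \<le> card (carrier G). \<Sum>k=1..card (carrier G).
     (real p - 1) / real p ^ k *
     (real (multiplicity p (torsion_card G (p ^ k))) - real (multiplicity p (torsion_card G (p ^ (k - 1))))))"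

lemma sum_prime_power_layers:
  fixes p :: nat
  assumes "p > 0" "a \<le> M"
  shows "(\<Sum>k=1..M. (real p - 1) / real p ^ k * (if k \<le> a then 1 else 0)) = 1 - 1 / real (p ^ a)"
proof -
  have "(\<Sum>k=1..M. (real p - 1) / real p ^ k * (if k \<le> a then 1 else 0))
    = (\<Sum>k=1..a. (real p - 1) / real p ^ k)"
    using assms(2) by (intro sum.mono_neutral_cong_right) auto
  also have "\<dots> = 1 - 1 / real p ^ a"
  proof (induction a)
    case (Suc a)
    have "(\<Sum>k=1..Suc a. (real p - 1) / real p ^ k) = (1 - 1 / real p ^ a) + (real p - 1) / real p ^ Suc a"
      using Suc by simp
    also have "\<dots> = 1 - 1 / real p ^ Suc a" using assms(1) by (simp add: field_simps)
    finally show ?case .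
  qed simp
  finally show ?thesis by simp
qed

text \<open>For a prime p, the k-th increment of the valuation counts the summands with
  \<open>q i = p\<close> and \<open>a i \<ge> k\<close>. Exchanging the sums collects, for each
  summand, the layers that add up to 1 - 1/q^a. The right-hand side depends on \<open>G\<close>
  alone.\<close>

lemma decomposition_sum_eq:
  assumes "group G" "prime_power_decomposition G r q a"
  shows "(\<Sum>i<r. 1 - 1 / real (q i ^ a i)) = torsion_invariant G"
proof -
  let ?X = "\<lambda>i. integer_mod_group (q i ^ a i)"
  let ?M = "card (carrier G)"
  have pr: "Factorial_Ring.prime (q i)" "a i \<ge> 1" "q i ^ a i > 0" if "i < r" for i
    using assms(2) that prime_gt_0_nat by (auto simp: prime_power_decomposition_def)
  have iso: "G \<cong> product_group {..<r} ?X" using assms(2) by (simp add: prime_power_decomposition_def)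
  have tc: "torsion_card G k = (\<Prod>i<r. gcd (q i ^ a i) k)" if "k > 0" for k
  proof -
    have "torsion_card G k = torsion_card (product_group {..<r} ?X) k"
      using assms(1) iso by (intro torsion_card_iso) auto
    also have "\<dots> = (\<Prod>i<r. torsion_card (?X i) k)" by (rule torsion_card_product_group) auto
    also have "\<dots> = (\<Prod>i<r. gcd (q i ^ a i) k)"
      using that pr by (intro prod.cong) (auto simp: torsion_card_cyclic)
    finally show ?thesis .
  qed
  have mult: "multiplicity p (torsion_card G (p ^ k)) = (\<Sum>i<r. if q i = p then min (a i) k else 0)"
    if "Factorial_Ring.prime p" for p k
  proof -
    have "multiplicity p (torsion_card G (p ^ k)) = multiplicity p (\<Prod>i<r. gcd (q i ^ a i) (p ^ k))"
      using that prime_gt_0_nat tc by simp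
    also have "\<dots> = (\<Sum>i<r. multiplicity p (gcd (q i ^ a i) (p ^ k)))"
      using that prime_gt_0_nat by (intro prime_elem_multiplicity_prod_distrib) auto
    also have "\<dots> = (\<Sum>i<r. if q i = p then min (a i) k else 0)"
      using that pr by (intro sum.cong) (auto simp: gcd_prime_powers multiplicity_same_power prime_gt_0_nat)
    finally show ?thesis .
  qed
  have cardG: "?M = (\<Prod>i<r. q i ^ a i)"
  proof -
    have "?M = card (carrier (product_group {..<r} ?X))" using iso by (rule iso_same_card)
    also have "\<dots> = (\<Prod>i<r. card (carrier (?X i)))" by (simp add: card_PiE)
    also have "\<dots> = (\<Prod>i<r. q i ^ a i)"
      using pr by (intro prod.cong) (auto simp: carrier_integer_mod_group nat_power_eq)
    finally show ?thesis .
  qed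
  \<comment> \<open>The ranges in \<open>torsion_invariant\<close> stop at the order of
    \<open>G\<close>; no prime and no exponent of the decomposition lies beyond.\<close>
  have bound: "q i \<le> ?M" "a i \<le> ?M" if "i < r" for i
  proof -
    have "q i ^ a i dvd ?M" unfolding cardG using that by (intro dvd_prodI) auto
    moreover have "?M > 0" unfolding cardG using pr by (intro prod_pos) auto
    ultimately have le: "q i ^ a i \<le> ?M" by (rule dvd_imp_le)
    have "q i \<le> q i ^ a i" using pr[OF that] by (cases "a i") auto
    then show "q i \<le> ?M" using le by simp
    have "a i < q i ^ a i" 
      using power_gt_expt[of "q i" "a i"] prime_gt_1_nat[OF pr(1)[OF that]] by simp
    then show "a i \<le> ?M" using le by simp
  qed
  have diff: "real (multiplicity p (torsion_card G (p ^ k))) - real (multiplicity p (torsion_card G (p ^ (k - 1))))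
     = (\<Sum>i<r. if q i = p then (if k \<le> a i then 1 else 0) else 0)"
    if "Factorial_Ring.prime p" "k \<ge> 1" for p k
    unfolding mult[OF that(1)] of_nat_sum sum_subtractf[symmetric]
    using that(2) by (intro sum.cong) (auto simp: min_def)
  have fin: "finite {p. Factorial_Ring.prime p \<and> p \<le> ?M}" by simp
  have "torsion_invariant G = (\<Sum>p | Factorial_Ring.prime p \<and> p \<le> ?M. \<Sum>k=1..?M. \<Sum>i<r.
     (if q i = p then (real p - 1) / real p ^ k * (if k \<le> a i then 1 else 0) else 0))"
    unfolding torsion_invariant_def
    by (intro sum.cong refl, subst diff) (auto simp: sum_distrib_left intro!: sum.cong)
  also have "\<dots> = (\<Sum>p | Factorial_Ring.prime p \<and> p \<le> ?M. \<Sum>i<r. \<Sum>k=1..?M.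
     (if q i = p then (real p - 1) / real p ^ k * (if k \<le> a i then 1 else 0) else 0))"
    by (intro sum.cong refl sum.swap)
  also have "\<dots> = (\<Sum>i<r. \<Sum>p | Factorial_Ring.prime p \<and> p \<le> ?M. \<Sum>k=1..?M.
     (if q i = p then (real p - 1) / real p ^ k * (if k \<le> a i then 1 else 0) else 0))"
    by (rule sum.swap)
  also have "\<dots> = (\<Sum>i<r. 1 - 1 / real (q i ^ a i))"
  proof (rule sum.cong[OF refl])
    fix i assume "i \<in> {..<r}"
    then have i: "i < r" by simp
    have "(\<Sum>p | Factorial_Ring.prime p \<and> p \<le> ?M. \<Sum>k=1..?M.
       (if q i = p then (real p - 1) / real p ^ k * (if k \<le> a i then 1 else 0) else 0))
      = (\<Sum>p | Factorial_Ring.prime p \<and> p \<le> ?M. if q i = p then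
          (\<Sum>k=1..?M. (real p - 1) / real p ^ k * (if k \<le> a i then 1 else 0)) else 0)"
      by (intro sum.cong) auto
    also have "\<dots> = (\<Sum>k=1..?M. (real (q i) - 1) / real (q i) ^ k * (if k \<le> a i then 1 else 0))"
      using fin pr(1)[OF i] bound(1)[OF i] by simp
    also have "\<dots> = 1 - 1 / real (q i ^ a i)"
      using bound[OF i] pr[OF i] prime_gt_0_nat by (intro sum_prime_power_layers) auto
    finally show "(\<Sum>p | Factorial_Ring.prime p \<and> p \<le> ?M. \<Sum>k=1..?M.
       (if q i = p then (real p - 1) / real p ^ k * (if k \<le> a i then 1 else 0) else 0)) = 1 - 1 / real (q i ^ a i)" .
  qed
  finally show ?thesis by simp
qed

lemma k_star_eq:
  assumes "group G" "prime_power_decomposition G r q a"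
  shows "k_star G = (\<Sum>i<r. 1 - 1 / real (q i ^ a i))"
  unfolding k_star_def
proof (rule the_equality)
  show "\<exists>(r'::nat) (q'::nat \<Rightarrow> nat) (a'::nat \<Rightarrow> nat). (\<forall>i<r'. Factorial_Ring.prime (q' i) \<and> 1 \<le> a' i) \<and>
       G \<cong> product_group {..<r'} (\<lambda>i. integer_mod_group (q' i ^ a' i)) \<and>
       (\<Sum>i<r. 1 - 1 / real (q i ^ a i)) = (\<Sum>i<r'. 1 - 1 / real (q' i ^ a' i))"
    using assms(2) unfolding prime_power_decomposition_def
    by (intro exI[of _ r] exI[of _ q] exI[of _ a]) simp
next
  fix x assume "\<exists>(r'::nat) (q'::nat \<Rightarrow> nat) (a'::nat \<Rightarrow> nat). (\<forall>i<r'. Factorial_Ring.prime (q' i) \<and> 1 \<le> a' i) \<and>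
       G \<cong> product_group {..<r'} (\<lambda>i. integer_mod_group (q' i ^ a' i)) \<and>
       x = (\<Sum>i<r'. 1 - 1 / real (q' i ^ a' i))"
  then obtain r' q' a' where "prime_power_decomposition G r' q' a'" "x = (\<Sum>i<r'. 1 - 1 / real (q' i ^ a' i))"
    unfolding prime_power_decomposition_def by blast
  then show "x = (\<Sum>i<r. 1 - 1 / real (q i ^ a i))"
    using decomposition_sum_eq[OF assms(1)] assms(2) by metis
qed

section \<open>Adjoining a cyclic factor to a decomposition\<close>

lemma product_group_Suc:
  "X r \<times>\<times> product_group {..<r} X \<cong> product_group {..<Suc r} X"
proof (rule is_isoI)
  let ?h = "\<lambda>(c, f). f(r := c)"
  show "?h \<in> iso (X r \<times>\<times> product_group {..<r} X) (product_group {..<Suc r} X)"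
    unfolding iso_def
  proof (intro CollectI conjI)
    show "?h \<in> hom (X r \<times>\<times> product_group {..<r} X) (product_group {..<Suc r} X)"
    proof (rule homI; clarify)
      fix c f assume "(c, f) \<in> carrier (X r \<times>\<times> product_group {..<r} X)"
      then show "f(r := c) \<in> carrier (product_group {..<Suc r} X)"
        by (auto simp: lessThan_Suc intro!: PiE_fun_upd)
    next
      fix c f d g
      assume "(c, f) \<in> carrier (X r \<times>\<times> product_group {..<r} X)"
        "(d, g) \<in> carrier (X r \<times>\<times> product_group {..<r} X)"
      show "?h ((c, f) \<otimes>\<^bsub>X r \<times>\<times> product_group {..<r} X\<^esub> (d, g))
        = f(r := c) \<otimes>\<^bsub>product_group {..<Suc r} X\<^esub> g(r := d)"
        by (rule ext) (simp add: less_Suc_eq)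
    qed
    show "bij_betw ?h (carrier (X r \<times>\<times> product_group {..<r} X)) (carrier (product_group {..<Suc r} X))"
    proof (rule bij_betw_byWitness[where f' = "\<lambda>f. (f r, restrict f {..<r})"])
      show "\<forall>z\<in>carrier (X r \<times>\<times> product_group {..<r} X). ((?h z) r, restrict (?h z) {..<r}) = z"
        by (auto simp: PiE_def extensional_def restrict_def)
      show "\<forall>f\<in>carrier (product_group {..<Suc r} X). ?h (f r, restrict f {..<r}) = f"
      proof (rule ballI, rule ext)
        fix f i assume "f \<in> carrier (product_group {..<Suc r} X)"
        then have "\<not> i < Suc r \<Longrightarrow> f i = undefined" by (auto simp: PiE_def extensional_def)
        then show "(?h (f r, restrict f {..<r})) i = f i" by (auto simp: less_Suc_eq)
      qed
      show "?h ` carrier (X r \<times>\<times> product_group {..<r} X) \<subseteq> carrier (product_group {..<Suc r} X)"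
        by (auto simp: lessThan_Suc intro!: PiE_fun_upd)
      show "(\<lambda>f. (f r, restrict f {..<r})) ` carrier (product_group {..<Suc r} X)
          \<subseteq> carrier (X r \<times>\<times> product_group {..<r} X)"
        by (auto simp: PiE_def Pi_def)
    qed
  qed
qed

lemma product_group_cong:
  assumes "\<And>i. i \<in> I \<Longrightarrow> X i = Y i"
  shows "product_group I X = product_group I Y"
  using assms by (auto simp: product_group_def intro!: PiE_cong restrict_ext ext)

lemma prime_power_decomposition_cyclic_times:
  assumes "group G" "prime_power_decomposition G r q a" "Factorial_Ring.prime p" "m \<ge> 1"
  shows "prime_power_decomposition (integer_mod_group (p ^ m) \<times>\<times> G) (Suc r) (q(r := p)) (a(r := m))"
proof -
  let ?Y = "\<lambda>i. integer_mod_group ((q(r := p)) i ^ (a(r := m)) i)"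
  have "G \<cong> product_group {..<r} (\<lambda>i. integer_mod_group (q i ^ a i))"
    using assms(2) by (simp add: prime_power_decomposition_def)
  also have "product_group {..<r} (\<lambda>i. integer_mod_group (q i ^ a i)) = product_group {..<r} ?Y"
    by (rule product_group_cong) auto
  finally have "integer_mod_group (p ^ m) \<times>\<times> G \<cong> ?Y r \<times>\<times> product_group {..<r} ?Y"
    using group.DirProd_iso_trans[OF group_integer_mod_group iso_refl] by simp
  also have "\<dots> \<cong> product_group {..<Suc r} ?Y" by (rule product_group_Suc)
  finally show ?thesis using assms(2-4) by (auto simp: prime_power_decomposition_def less_Suc_eq)
qed

lemma k_star_cyclic_times:
  assumes "group G" "prime_power_decomposition G r q a" "Factorial_Ring.prime p" "m \<ge> 1"
  shows "k_star (integer_mod_group (p ^ m) \<times>\<times> G) = (1 - 1 / real (p ^ m)) + k_star G"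
proof -
  have "group (integer_mod_group (p ^ m) \<times>\<times> G)" using assms(1) by (intro DirProd_group) auto
  then show ?thesis
    using k_star_eq[OF _ prime_power_decomposition_cyclic_times[OF assms]] k_star_eq[OF assms(1,2)]
    by simp
qed

section \<open>Decomposition into cyclic groups of prime power order\<close>

context fin_comm_group
begin

lemma cyclic_subgroup_eq:
  assumes "x \<in> carrier G"
  shows "generate G {x} = range (\<lambda>k::nat. x [^] k)"
  using generate_pow_on_finite_carrier[OF fin assms] by auto

lemma subgroup_pow_closed:
  assumes "subgroup M G" "z \<in> M" shows "z [^] (k::nat) \<in> M"
  using assms by (induction k) (auto simp: subgroup.one_closed subgroup.m_closed)

lemma nat_pow_mod_ord:
  assumes "x \<in> carrier G" shows "x [^] (k mod ord x) = x [^] k"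
proof -
  have "x [^] k = x [^] (ord x * (k div ord x) + k mod ord x)" by simp
  also have "\<dots> = (x [^] ord x) [^] (k div ord x) \<otimes> x [^] (k mod ord x)"
    using assms by (simp only: nat_pow_mult nat_pow_pow)
  also have "\<dots> = x [^] (k mod ord x)" using assms by simp
  finally show ?thesis by simp
qed

text \<open>Let k be the least positive exponent with y^k in \<open>M\<close> and q a prime factor
  of k. Then z = y^(k/q) is outside \<open>M\<close> by minimality, while z^q = y^k is
  inside.\<close>

lemma prime_index_element:
  assumes M: "subgroup M G" and y: "y \<in> carrier G" "y \<notin> M"
  obtains z q where "z \<in> carrier G" "z \<notin> M" "Factorial_Ring.prime q" "z [^] (q::nat) \<in> M"
proof -
  define k where "k = (LEAST k. k > 0 \<and> y [^] (k::nat) \<in> M)"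
  have ex: "ord y > 0 \<and> y [^] ord y \<in> M" using y M ord_pos by (simp add: subgroup.one_closed)
  have k: "k > 0" "y [^] k \<in> M"
    using LeastI[of "\<lambda>k. k > 0 \<and> y [^] (k::nat) \<in> M", OF ex] by (auto simp: k_def)
  have least: "\<not> (j > 0 \<and> y [^] j \<in> M)" if "j < k" for j
    using not_less_Least[of j "\<lambda>k. k > 0 \<and> y [^] (k::nat) \<in> M"] that unfolding k_def by blast
  have "k \<noteq> 1" using k y by auto
  then obtain q where q: "Factorial_Ring.prime q" "q dvd k" using prime_factor_nat by blast
  then obtain l where l: "k = l * q" by (metis dvd_def mult.commute)
  have "l < k" "l > 0" using l k(1) prime_gt_1_nat[OF q(1)] by auto
  then have "y [^] l \<notin> M" using least by blast
  moreover have "(y [^] l) [^] q \<in> M" using k l y by (simp add: nat_pow_pow)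
  ultimately show ?thesis using that[of "y [^] l" q] y q by simp
qed

text \<open>Any subgroup that is maximal among those meeting the cyclic group of \<open>x\<close> trivially is a
  complement.\<close>

lemma cyclic_direct_factor:
  assumes p: "Factorial_Ring.prime p" and x: "x \<in> carrier G" "ord x = p ^ a" "a \<ge> 1"
    and max: "\<And>y b. y \<in> carrier G \<Longrightarrow> ord y = p ^ b \<Longrightarrow> b \<le> a"
  obtains B where "subgroup B G" "generate G {x} \<inter> B = {\<one>}" "generate G {x} <#> B = carrier G"
proof -
  define A where "A = generate G {x}"
  have A: "subgroup A G" unfolding A_def using x by (intro generate_is_subgroup) auto
  have Apow: "A = range (\<lambda>k::nat. x [^] k)" unfolding A_def using cyclic_subgroup_eq x by blast
  have order0: "order G > 0" using fin by (simp add: order_gt_0_iff_finite)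
  define m where "m = order G div p ^ multiplicity p (order G)"
  have om: "order G = p ^ multiplicity p (order G) * m" 
    unfolding m_def using multiplicity_dvd[of p "order G"] by simp
  have pm: "\<not> p dvd m"
    unfolding m_def using order0 p by (intro multiplicity_decompose) auto
  \<comment> \<open>\<open>m\<close> is the part of the group order prime to p. The power y^m has
    p-power order, which is at most p^a by maximality of \<open>a\<close>.\<close>
  have exponent: "y [^] (p ^ a * m) = \<one>" if y: "y \<in> carrier G" for y
  proof -
    have "(y [^] m) [^] (p ^ multiplicity p (order G)) = \<one>"
      using y pow_order_eq_1[OF y] om by (simp add: nat_pow_pow mult.commute)
    then have "ord (y [^] m) dvd p ^ multiplicity p (order G)" using y pow_eq_id by simp
    then obtain b where b: "ord (y [^] m) = p ^ b" using divides_primepow_nat[OF p] by auto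
    then have "ord (y [^] m) dvd p ^ a" using max[of "y [^] m" b] y by (simp add: le_imp_power_dvd)
    then have "(y [^] m) [^] (p ^ a) = \<one>" using y pow_eq_id by simp
    then show ?thesis using y by (simp add: nat_pow_pow mult.commute)
  qed
  let ?P = "\<lambda>B. subgroup B G \<and> A \<inter> B = {\<one>}"
  have "?P {\<one>}" using triv_subgroup A subgroup.one_closed by auto
  moreover have "\<forall>B. ?P B \<longrightarrow> card B < Suc (card (carrier G))"
    using fin subgroup.subset by (auto simp: less_Suc_eq_le intro!: card_mono)
  ultimately obtain B where B: "?P B" and Bmax: "\<And>B'. ?P B' \<Longrightarrow> card B' \<le> card B"
    using ex_has_greatest_nat[of ?P "{\<one>}" card "Suc (card (carrier G))"] by blast
  have sB: "subgroup B G" using B by simp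
  have sM: "subgroup (A <#> B) G" using A B mult_subgroups by blast
  have AM: "A \<subseteq> A <#> B"
  proof
    fix u assume "u \<in> A"
    then have "u \<otimes> \<one> \<in> A <#> B" unfolding set_mult_def using subgroup.one_closed[OF sB] by blast
    then show "u \<in> A <#> B" using \<open>u \<in> A\<close> subgroup.mem_carrier[OF A] by simp
  qed
  have BM: "B \<subseteq> A <#> B"
  proof
    fix u assume "u \<in> B"
    then have "\<one> \<otimes> u \<in> A <#> B" unfolding set_mult_def using subgroup.one_closed[OF A] by blast
    then show "u \<in> A <#> B" using \<open>u \<in> B\<close> subgroup.mem_carrier[OF sB] by simp
  qed
  have "A <#> B = carrier G"
  proof (rule ccontr)
    assume "A <#> B \<noteq> carrier G"
    then obtain y0 where "y0 \<in> carrier G" "y0 \<notin> A <#> B" using subgroup.subset[OF sM] by blast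
    then obtain y q where y: "y \<in> carrier G" "y \<notin> A <#> B" and q: "Factorial_Ring.prime q"
      and yq: "y [^] (q::nat) \<in> A <#> B"
      using prime_index_element[OF sM] by metis
    obtain s b where sb: "y [^] q = x [^] (s::nat) \<otimes> b" "b \<in> B"
      using yq Apow by (auto simp: set_mult_def)
    have bc: "b \<in> carrier G" using sb(2) subgroup.mem_carrier[OF sB] by blast
    \<comment> \<open>The aim is to correct \<open>y\<close> by a power of \<open>x\<close> so that
      its q-th power falls into \<open>B\<close>; for this the exponent \<open>s\<close> must be
      divisible by q modulo p^a.\<close>
    have "\<exists>t::nat. [q * t = s] (mod p ^ a)"
    proof (cases "q = p")
      case False
      then have "coprime q (p ^ a)" using primes_coprime[OF q p] by simp
      then obtain t0 where "[q * t0 = Suc 0] (mod p ^ a)" using cong_solve_coprime_nat by blast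
      from cong_mult[OF this cong_refl[of s]]
      have "[q * (t0 * s) = s] (mod p ^ a)" by (simp add: mult.assoc)
      then show ?thesis by auto
    next
      case True
      \<comment> \<open>Raising y^p = x^s b to this power makes the left side trivial, so x^(s k)
        lies in both \<open>A\<close> and \<open>B\<close> and is trivial. Thus p^a divides s
        p^(a-1) m, and p divides s.\<close>
      let ?k = "p ^ (a - 1) * m"
      have pk: "q * ?k = p ^ a * m" using x(3) True by (cases a) auto
      have "\<one> = (y [^] q) [^] ?k" 
        unfolding nat_pow_pow[OF y(1)] pk using exponent[OF y(1)] by simp
      also have "\<dots> = x [^] (s * ?k) \<otimes> b [^] ?k"
        unfolding sb(1) using x(1) bc by (simp add: pow_mult_distrib m_comm nat_pow_pow)
      finally have "x [^] (s * ?k) = inv (b [^] ?k)"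
        using x(1) bc by (metis inv_equality nat_pow_closed)
      moreover have "inv (b [^] ?k) \<in> B"
        using subgroup_pow_closed[OF sB sb(2)] subgroup.m_inv_closed[OF sB] by blast
      moreover have "x [^] (s * ?k) \<in> A" using Apow by blast
      ultimately have "x [^] (s * ?k) = \<one>" using B by auto
      then have "p ^ a dvd s * ?k" using x pow_eq_id by metis
      moreover have "p ^ a = p * p ^ (a - 1)" using x(3) by (cases a) auto
      ultimately have "p * p ^ (a - 1) dvd (s * m) * p ^ (a - 1)" by (simp add: mult_ac)
      then have "p dvd s * m" using prime_gt_0_nat[OF p] by (simp add: mult_dvd_mono)
      then have "p dvd s" using pm p by (simp add: prime_dvd_mult_iff)
      then show ?thesis using True by (metis cong_refl dvdE)
    qed
    then obtain t :: nat where t: "[q * t = s] (mod p ^ a)" by blast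
    have xs: "x [^] s = x [^] (t * q)"
    proof -
      have "s mod ord x = (t * q) mod ord x" using t x(2) by (simp add: cong_def mult.commute)
      then show ?thesis using nat_pow_mod_ord[OF x(1)] by metis
    qed
    define z where "z = y \<otimes> inv (x [^] t)"
    have xt: "x [^] t \<in> A" using Apow by blast
    have zc: "z \<in> carrier G" unfolding z_def using y x by simp
    have yz: "y = z \<otimes> x [^] t" unfolding z_def using y x by (simp add: m_assoc)
    have zM: "z \<notin> A <#> B"
    proof
      assume "z \<in> A <#> B"
      then have "z \<otimes> x [^] t \<in> A <#> B" using AM xt subgroup.m_closed[OF sM] by blast
      then show False using y yz by simp
    qed
    have zq: "z [^] q = b"
    proof -
      have "z [^] q \<otimes> x [^] (t * q) = y [^] q"
        unfolding yz using zc x(1) by (simp add: pow_mult_distrib m_comm nat_pow_pow)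
      also have "\<dots> = b \<otimes> x [^] (t * q)" using sb(1) xs bc x(1) by (simp add: m_comm)
      finally show ?thesis using zc bc x(1) by simp
    qed
    define C where "C = generate G {z}"
    have sC: "subgroup C G" unfolding C_def using zc by (intro generate_is_subgroup) auto
    have Cpow: "C = range (\<lambda>k::nat. z [^] k)" unfolding C_def using cyclic_subgroup_eq zc by blast
    have sBC: "subgroup (B <#> C) G" using sB sC mult_subgroups by blast
    \<comment> \<open>If q divides the exponent i, then z^i is in \<open>B\<close> already.
      Otherwise z is a combination of z^i and z^q, both in \<open>A <#> B\<close>, which is
      impossible. Hence \<open>B <#> C\<close> contradicts the maximality of
      \<open>B\<close>.\<close>
    have "A \<inter> (B <#> C) \<subseteq> {\<one>}"
    proof
      fix u assume u: "u \<in> A \<inter> (B <#> C)"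
      then obtain b' and i :: nat where bi: "b' \<in> B" "u = b' \<otimes> z [^] i"
        by (auto simp: set_mult_def Cpow)
      have b'c: "b' \<in> carrier G" using bi(1) subgroup.mem_carrier[OF sB] by blast
      show "u \<in> {\<one>}"
      proof (cases "q dvd i")
        case True
        then obtain l where "i = q * l" by blast
        then have "z [^] i = b [^] l" using zq zc by (simp add: nat_pow_pow[symmetric])
        then have "z [^] i \<in> B" using subgroup_pow_closed[OF sB sb(2)] by simp
        then have "u \<in> B" using bi subgroup.m_closed[OF sB] by blast
        then show ?thesis using u B by auto
      next
        case False
        have "z [^] i = inv b' \<otimes> u" using bi b'c zc by (simp add: m_assoc[symmetric])
        moreover have "inv b' \<in> A <#> B" using bi(1) BM subgroup.m_inv_closed[OF sB] by blast
        moreover have "u \<in> A <#> B" using u AM by blast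
        ultimately have zi: "z [^] i \<in> A <#> B" using subgroup.m_closed[OF sM] by metis
        have zqM: "z [^] q \<in> A <#> B" using zq sb(2) BM by blast
        have "coprime i q" using False q prime_imp_coprime by (metis coprime_commute)
        then obtain j where j: "[i * j = Suc 0] (mod q)" using cong_solve_coprime_nat by blast
        have "(i * j) mod q = 1" using j prime_gt_1_nat[OF q] by (simp add: cong_def)
        then have "i * j = q * ((i * j) div q) + 1" by (metis mult_div_mod_eq)
        then have "z [^] (i * j) = (z [^] q) [^] ((i * j) div q) \<otimes> z"
          using zc by (metis nat_pow_mult nat_pow_pow nat_pow_eone)
        moreover have "z [^] (i * j) = (z [^] i) [^] j" using zc by (simp add: nat_pow_pow)
        ultimately have "z = inv ((z [^] q) [^] ((i * j) div q)) \<otimes> (z [^] i) [^] j"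
          using zc by (simp add: m_assoc[symmetric])
        then have "z \<in> A <#> B"
          using subgroup_pow_closed[OF sM zi] subgroup_pow_closed[OF sM zqM]
            subgroup.m_inv_closed[OF sM] subgroup.m_closed[OF sM] by metis
        then show ?thesis using zM by blast
      qed
    qed
    then have "?P (B <#> C)" using sBC subgroup.one_closed[OF A] subgroup.one_closed[OF sBC] by blast
    then have "card (B <#> C) \<le> card B" by (rule Bmax)
    moreover have "B \<subset> B <#> C"
    proof (rule psubsetI)
      show "B \<subseteq> B <#> C"
      proof
        fix u assume "u \<in> B"
        then have "u \<otimes> \<one> \<in> B <#> C" unfolding set_mult_def using subgroup.one_closed[OF sC] by blast
        then show "u \<in> B <#> C" using \<open>u \<in> B\<close> subgroup.mem_carrier[OF sB] by simp
      qed
      have "z \<in> C" unfolding C_def by (simp add: generate.incl)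
      then have "\<one> \<otimes> z \<in> B <#> C" unfolding set_mult_def using subgroup.one_closed[OF sB] by blast
      then have "z \<in> B <#> C" using zc by simp
      then show "B \<noteq> B <#> C" using zM BM by blast
    qed
    then have "card B < card (B <#> C)"
      using finite_subset[OF subgroup.subset[OF sBC] fin] by (rule psubset_card_mono[rotated])
    ultimately show False by simp
  qed
  then show ?thesis using that[of B] B A_def by simp
qed

lemma cyclic_subgroup_iso:
  assumes "x \<in> carrier G"
  shows "integer_mod_group (ord x) \<cong> subgroup_generated G (generate G {x})"
proof (rule is_isoI)
  let ?n = "ord x"
  have n: "?n > 0" using ord_pos assms by blast
  have sg: "subgroup (generate G {x}) G" using assms by (intro generate_is_subgroup) auto
  have car: "carrier (subgroup_generated G (generate G {x})) = generate G {x}"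
    using sg by (rule subgroup.carrier_subgroup_generated_subgroup)
  have gen: "generate G {x} = range (\<lambda>k::nat. x [^] k)" using cyclic_subgroup_eq assms by blast
  show "(\<lambda>i. x [^] nat i) \<in> iso (integer_mod_group ?n) (subgroup_generated G (generate G {x}))"
    unfolding iso_def
  proof (intro CollectI conjI)
    show "(\<lambda>i. x [^] nat i) \<in> hom (integer_mod_group ?n) (subgroup_generated G (generate G {x}))"
    proof (rule homI)
      fix i j assume ij: "i \<in> carrier (integer_mod_group ?n)" "j \<in> carrier (integer_mod_group ?n)"
      then have nn: "i \<ge> 0" "j \<ge> 0" using n by (auto simp: carrier_integer_mod_group)
      have "nat ((i + j) mod int ?n) = (nat i + nat j) mod ?n"
        using nn by (simp add: nat_mod_distrib nat_add_distrib)
      then show "x [^] nat (i \<otimes>\<^bsub>integer_mod_group ?n\<^esub> j)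
          = x [^] nat i \<otimes>\<^bsub>subgroup_generated G (generate G {x})\<^esub> x [^] nat j"
        using assms by (simp add: nat_pow_mult nat_pow_mod_ord)
    qed (use gen car in auto)
    show "bij_betw (\<lambda>i. x [^] nat i) (carrier (integer_mod_group ?n))
        (carrier (subgroup_generated G (generate G {x})))"
      unfolding bij_betw_def
    proof
      show "inj_on (\<lambda>i. x [^] nat i) (carrier (integer_mod_group ?n))"
      proof (rule inj_onI)
        fix i j assume ij: "i \<in> carrier (integer_mod_group ?n)" "j \<in> carrier (integer_mod_group ?n)"
          "x [^] nat i = x [^] nat j"
        then have b: "0 \<le> i" "i < int ?n" "0 \<le> j" "j < int ?n" using n by (auto simp: carrier_integer_mod_group)
        then have "nat i \<in> {0..ord x - 1}" "nat j \<in> {0..ord x - 1}" by auto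
        then have "nat i = nat j" using ord_inj[OF assms] ij(3) by (auto dest: inj_onD)
        then show "i = j" using b by simp
      qed
      show "(\<lambda>i. x [^] nat i) ` carrier (integer_mod_group ?n) = carrier (subgroup_generated G (generate G {x}))"
      proof
        show "carrier (subgroup_generated G (generate G {x})) \<subseteq> (\<lambda>i. x [^] nat i) ` carrier (integer_mod_group ?n)"
        proof
          fix u assume "u \<in> carrier (subgroup_generated G (generate G {x}))"
          then obtain k :: nat where k: "u = x [^] k" using car gen by auto
          then have "u = x [^] nat (int (k mod ?n))" using nat_pow_mod_ord assms by simp
          moreover have "int (k mod ?n) \<in> carrier (integer_mod_group ?n)" using n by (simp add: carrier_integer_mod_group)
          ultimately show "u \<in> (\<lambda>i. x [^] nat i) ` carrier (integer_mod_group ?n)" by blast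
        qed
      qed (use gen car in auto)
    qed
  qed
qed

end

text \<open>Induction on the order: an element of maximal p-power order generates a direct factor,
  and its complement is smaller.\<close>

theorem prime_power_decomposition_exists:
  assumes "fin_comm_group G"
  shows "\<exists>r q a. prime_power_decomposition G r q a"
  using assms
proof (induction "card (carrier G)" arbitrary: G rule: less_induct)
  case less
  interpret fin_comm_group G by fact
  show ?case
  proof (cases "carrier G = {\<one>\<^bsub>G\<^esub>}")
    case True
    \<comment> \<open>The product over no indices has one element, the function that is undefined
      everywhere; \<open>0 ^ 0\<close> is a mere placeholder.\<close>
    have "(\<lambda>_ _. undefined) \<in> iso G (product_group {..<(0::nat)} (\<lambda>i. integer_mod_group (0 ^ 0)))"
      using True by (auto simp: iso_def hom_def bij_betw_def)
    then have "prime_power_decomposition G 0 (\<lambda>_. 0) (\<lambda>_. 0)"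
      by (auto simp: prime_power_decomposition_def intro: is_isoI)
    then show ?thesis by blast
  next
    case False
    then obtain y where y: "y \<in> carrier G" "y \<noteq> \<one>\<^bsub>G\<^esub>" using one_closed by blast
    then have "ord y \<noteq> 1" using ord_eq_1 by blast
    then obtain p where p: "Factorial_Ring.prime p" "p dvd ord y" using prime_factor_nat by blast
    then obtain l where l: "ord y = p * l" by blast
    have l0: "l \<noteq> 0" using l ord_pos[OF y(1)] by (metis mult_0_right less_irrefl)
    have ordyl: "ord (y [^]\<^bsub>G\<^esub> l) = p"
      using ord_pow[OF y(1), of l] l l0 by simp
    let ?Q = "\<lambda>a. \<exists>x\<in>carrier G. ord x = p ^ a"
    have Q1: "?Q 1" using ordyl y by (intro bexI[of _ "y [^]\<^bsub>G\<^esub> l"]) auto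
    have bnd: "a < card (carrier G)" if Qa: "?Q a" for a
    proof -
      obtain x where x: "x \<in> carrier G" "ord x = p ^ a" using Qa by blast
      have "a < p ^ a" using prime_gt_1_nat[OF p(1)] power_gt_expt[of p a] by simp
      also have "p ^ a \<le> card (carrier G)" using ord_le_group_order[OF fin x(1)] x(2) by (simp add: order_def)
      finally show ?thesis .
    qed
    obtain a where a: "?Q a" and amax: "\<And>b. ?Q b \<Longrightarrow> b \<le> a"
      using ex_has_greatest_nat[of ?Q 1 "\<lambda>a. a" "card (carrier G)"] Q1 bnd by auto
    obtain x where x: "x \<in> carrier G" "ord x = p ^ a" using a by blast
    have a1: "a \<ge> 1" using amax[OF Q1] .
    obtain B where B: "subgroup B G" "generate G {x} \<inter> B = {\<one>\<^bsub>G\<^esub>}" "generate G {x} <#>\<^bsub>G\<^esub> B = carrier G"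
      using cyclic_direct_factor[OF p(1) x a1] amax by metis
    let ?A = "subgroup_generated G (generate G {x})"
    let ?B = "subgroup_generated G B"
    have sA: "subgroup (generate G {x}) G" using x by (intro generate_is_subgroup) auto
    have carB: "carrier ?B = B" using B(1) by (rule subgroup.carrier_subgroup_generated_subgroup)
    have xne: "x \<noteq> \<one>\<^bsub>G\<^esub>" using x a1 prime_gt_1_nat[OF p(1)] ord_eq_1[OF x(1)] by auto
    have "x \<in> generate G {x}" by (simp add: generate.incl)
    then have "x \<notin> B" using B(2) xne by auto
    then have "B \<subset> carrier G" using x subgroup.subset[OF B(1)] by blast
    then have lt: "card (carrier ?B) < card (carrier G)" using carB fin by (simp add: psubset_card_mono)
    have cgB: "comm_group ?B" by (rule abelian_subgroup_generated[OF comm_group_axioms])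
    have fB: "fin_comm_group ?B"
      using cgB carB finite_subset[OF subgroup.subset[OF B(1)] fin]
      by (simp add: fin_comm_group_def fin_comm_group_axioms_def)
    obtain r q e where dec: "prime_power_decomposition ?B r q e" using less.hyps[OF lt fB] by blast
    have gB: "group ?B" by simp
    have dec': "prime_power_decomposition (integer_mod_group (p ^ a) \<times>\<times> ?B) (Suc r) (q(r := p)) (e(r := a))"
      by (rule prime_power_decomposition_cyclic_times[OF gB dec p(1) a1])
    interpret group_disjoint_sum G "generate G {x}" B
      using sA B(1) by (simp add: group_disjoint_sum_def is_group)
    have "(\<lambda>(x, y). x \<otimes>\<^bsub>G\<^esub> y) \<in> iso (?A \<times>\<times> ?B) G"
      using iso_group_mul[OF comm_group_axioms] B by auto
    then have AB: "?A \<times>\<times> ?B \<cong> G" by (rule is_isoI)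
    have gAB: "group (?A \<times>\<times> ?B)" by (intro DirProd_group) auto
    have gCB: "group (integer_mod_group (p ^ a) \<times>\<times> ?B)" by (intro DirProd_group) auto
    have "integer_mod_group (p ^ a) \<cong> ?A" using cyclic_subgroup_iso[OF x(1)] x(2) by simp
    then have CB: "integer_mod_group (p ^ a) \<times>\<times> ?B \<cong> ?A \<times>\<times> ?B"
      using group.DirProd_iso_trans[OF group_integer_mod_group _ iso_refl] by blast
    have "G \<cong> integer_mod_group (p ^ a) \<times>\<times> ?B"
      using group.iso_sym[OF gCB iso_trans[OF CB AB]] .
    then have "prime_power_decomposition G (Suc r) (q(r := p)) (e(r := a))"
      using dec' iso_trans unfolding prime_power_decomposition_def by blast
    then show ?thesis by blast
  qed
qed

section \<open>The cross number of direct products\<close>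

text \<open>An injective homomorphism preserves orders and reflects vanishing sums, so it carries an
  extremal sequence to a zero-sum free one of equal cross number.\<close>

lemma little_cross_mono:
  assumes "fin_comm_group A" "fin_comm_group B" "h \<in> hom A B" "inj_on h (carrier A)"
  shows "little_cross A \<le> little_cross B"
proof -
  interpret A: fin_comm_group A by fact
  interpret B: fin_comm_group B by fact
  interpret group_hom A B h using assms(3) by unfold_locales
  have one: "h x = \<one>\<^bsub>B\<^esub> \<longleftrightarrow> x = \<one>\<^bsub>A\<^esub>" if "x \<in> carrier A" for x
    using that assms(4) by (metis A.one_closed hom_one inj_onD)
  have ord: "B.ord (h x) = A.ord x" if "x \<in> carrier A" for x
  proof (rule B.ord_unique[THEN iffD2])
    show "\<forall>n. (h x [^]\<^bsub>B\<^esub> n = \<one>\<^bsub>B\<^esub>) = (A.ord x dvd n)"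
      using that one by (simp add: hom_nat_pow[symmetric] A.pow_eq_id)
  qed (use that in simp)
  obtain S where S: "set_mset S \<subseteq> carrier A" "zero_sum_free A S" "cross_number A S = little_cross A"
    by (rule A.little_cross_attained)
  have hS: "set_mset (image_mset h S) \<subseteq> carrier B" using S(1) by auto
  have "cross_number B (image_mset h S) = (\<Sum>x\<in>#S. 1 / real (B.ord (h x)))"
    unfolding B.cross_number_eq[OF hS] by (simp add: image_mset.compositionality o_def)
  also have "{#1 / real (B.ord (h x)). x \<in># S#} = {#1 / real (A.ord x). x \<in># S#}"
    using S(1) ord by (intro image_mset_cong) auto
  finally have "cross_number B (image_mset h S) = cross_number A S"
    using A.cross_number_eq[OF S(1)] by simp
  moreover have "zero_sum_free B (image_mset h S)"
    unfolding zero_sum_free_def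
  proof (intro allI impI notI)
    fix T assume T: "T \<subseteq># image_mset h S \<and> T \<noteq> {#}" "seq_sum B T = \<one>\<^bsub>B\<^esub>"
    then obtain U where U: "U \<subseteq># S" "T = image_mset h U" by (auto elim: subset_mset_image_msetE)
    have Uc: "set_mset U \<subseteq> carrier A" using A.seq_over_subset S(1) U(1) by blast
    have "h (seq_sum A U) = \<one>\<^bsub>B\<^esub>" using seq_sum_hom[OF assms(1-3) Uc] T U by simp
    then have "seq_sum A U = \<one>\<^bsub>A\<^esub>" using one A.seq_sum_closed[OF Uc] by blast
    then show False using S(2) T U unfolding zero_sum_free_def by auto
  qed
  ultimately show ?thesis using B.cross_number_le_little_cross[OF hS] S(3) by simp
qed

text \<open>Extremal sequences of the two factors are concatenated; a vanishing subsum vanishes in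
  each component separately.\<close>

lemma little_cross_superadditive:
  assumes "fin_comm_group A" "fin_comm_group B"
  shows "little_cross A + little_cross B \<le> little_cross (A \<times>\<times> B)"
proof -
  interpret A: fin_comm_group A by fact
  interpret B: fin_comm_group B by fact
  note AB' = fin_comm_group_DirProd[OF assms]
  interpret AB: fin_comm_group "A \<times>\<times> B" by (rule AB')
  obtain S where S: "set_mset S \<subseteq> carrier A" "zero_sum_free A S" "cross_number A S = little_cross A"
    by (rule A.little_cross_attained)
  obtain T where T: "set_mset T \<subseteq> carrier B" "zero_sum_free B T" "cross_number B T = little_cross B"
    by (rule B.little_cross_attained)
  let ?i = "\<lambda>a. (a, \<one>\<^bsub>B\<^esub>)" and ?j = "\<lambda>b. (\<one>\<^bsub>A\<^esub>, b)"
  have hi: "?i \<in> hom A (A \<times>\<times> B)" and hj: "?j \<in> hom B (A \<times>\<times> B)" by (auto simp: hom_def)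
  have iS: "set_mset (image_mset ?i S) \<subseteq> carrier (A \<times>\<times> B)" using S(1) by auto
  have jT: "set_mset (image_mset ?j T) \<subseteq> carrier (A \<times>\<times> B)" using T(1) by auto
  let ?R = "image_mset ?i S + image_mset ?j T"
  have R: "set_mset ?R \<subseteq> carrier (A \<times>\<times> B)" using iS jT by simp
  have "{#1 / real (AB.ord (?i x)). x \<in># S#} = {#1 / real (A.ord x). x \<in># S#}"
    using S(1) by (intro image_mset_cong) (auto simp: ord_DirProd[OF A.is_group B.is_group])
  moreover have "{#1 / real (AB.ord (?j x)). x \<in># T#} = {#1 / real (B.ord x). x \<in># T#}"
    using T(1) by (intro image_mset_cong) (auto simp: ord_DirProd[OF A.is_group B.is_group])
  ultimately have "cross_number (A \<times>\<times> B) ?R = cross_number A S + cross_number B T"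
    unfolding AB.cross_number_eq[OF R] A.cross_number_eq[OF S(1)] B.cross_number_eq[OF T(1)]
    by (simp add: image_mset.compositionality o_def)
  moreover have "zero_sum_free (A \<times>\<times> B) ?R"
    unfolding zero_sum_free_def
  proof (intro allI impI notI)
    fix U assume U: "U \<subseteq># ?R \<and> U \<noteq> {#}" "seq_sum (A \<times>\<times> B) U = \<one>\<^bsub>A \<times>\<times> B\<^esub>"
    \<comment> \<open>An element may occur in both images only if it is the identity; the multiset
      intersection splits \<open>U\<close> without a case distinction.\<close>
    define U1 where "U1 = U \<inter># image_mset ?i S"
    have "U1 \<subseteq># image_mset ?i S" by (simp add: U1_def)
    then obtain V1 where V1: "V1 \<subseteq># S" "U1 = image_mset ?i V1" by (rule subset_mset_image_msetE)
    have "U - U1 \<subseteq># image_mset ?j T"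
      using U(1) unfolding U1_def
      by (simp add: diff_intersect_left_idem subset_eq_diff_conv union_commute)
    then obtain V2 where V2: "V2 \<subseteq># T" "U - U1 = image_mset ?j V2" by (rule subset_mset_image_msetE)
    have U12: "U = image_mset ?i V1 + image_mset ?j V2"
      using V1(2) V2(2) unfolding U1_def by (metis subset_mset.add_diff_inverse subset_mset.inf_le1)
    have c1: "set_mset V1 \<subseteq> carrier A" and c2: "set_mset V2 \<subseteq> carrier B"
      using S(1) T(1) V1(1) V2(1) A.seq_over_subset B.seq_over_subset by blast+
    have "seq_sum (A \<times>\<times> B) U = ?i (seq_sum A V1) \<otimes>\<^bsub>A \<times>\<times> B\<^esub> ?j (seq_sum B V2)"
      unfolding U12 seq_sum_hom[OF assms(1) AB' hi c1] seq_sum_hom[OF assms(2) AB' hj c2]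
      using c1 c2 by (intro AB.seq_sum_union) auto
    then have "seq_sum A V1 = \<one>\<^bsub>A\<^esub>" "seq_sum B V2 = \<one>\<^bsub>B\<^esub>" using U(2) c1 c2 by simp_all
    then have "V1 = {#}" "V2 = {#}" using S(2) T(2) V1(1) V2(1) unfolding zero_sum_free_def by auto
    then show False using U(1) U12 by simp
  qed
  ultimately show ?thesis using AB.cross_number_le_little_cross[OF R] S(3) T(3) by simp
qed

text \<open>The Olson function gives the upper bound; n - 1 copies of the generator 1 attain
  it.\<close>

lemma little_cross_cyclic:
  assumes p: "Factorial_Ring.prime p" and m: "m > 0"
  shows "little_cross (integer_mod_group (p ^ m)) = 1 - 1 / real (p ^ m)"
proof -
  let ?C = "integer_mod_group (p ^ m)"
  define n where "n = p ^ m"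
  have n: "n > 1" unfolding n_def using p m prime_gt_1_nat one_less_power by blast
  interpret C: fin_comm_group "integer_mod_group n"
    using n by (intro fin_comm_group_integer_mod_group) simp
  obtain S where S: "set_mset S \<subseteq> carrier (integer_mod_group n)" "zero_sum_free (integer_mod_group n) S"
    "cross_number (integer_mod_group n) S = little_cross (integer_mod_group n)"
    by (rule C.little_cross_attained)
  have "olson_fun p (integer_mod_group n) (1 - 1 / real n) (\<lambda>x. int ((nat x + (n - 1)) choose (n - 1)))"
    unfolding n_def by (rule olson_fun_cyclic[OF p])
  then have upper: "little_cross (integer_mod_group n) \<le> 1 - 1 / real n"
    using C.cross_number_le_olson[OF p _ S(1,2)] S(3) by simp
  have one: "1 \<in> carrier (integer_mod_group n)" using n by simp
  have ord1: "C.ord 1 = n"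
    by (rule C.ord_unique[OF one, THEN iffD2]) (auto simp flip: dvd_eq_mod_eq_0)
  let ?R = "replicate_mset (n - 1) (1::int)"
  have R: "set_mset ?R \<subseteq> carrier (integer_mod_group n)" using one n by auto
  have "zero_sum_free (integer_mod_group n) ?R"
    unfolding zero_sum_free_def
  proof (intro allI impI notI)
    fix T assume T: "T \<subseteq># ?R \<and> T \<noteq> {#}" "seq_sum (integer_mod_group n) T = \<one>\<^bsub>integer_mod_group n\<^esub>"
    then obtain k where k: "T = replicate_mset k 1" "k \<le> n - 1" "k > 0"
      by (metis msubseteq_replicate_msetE gr0I replicate_mset_0)
    then have "1 [^]\<^bsub>integer_mod_group n\<^esub> k = \<one>\<^bsub>integer_mod_group n\<^esub>"
      using T(2) C.seq_sum_replicate[OF one] by simp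
    then have "n dvd k" using C.pow_eq_id[OF one] ord1 by simp
    then show False using k n by (auto dest: dvd_imp_le)
  qed
  then have "cross_number (integer_mod_group n) ?R \<le> little_cross (integer_mod_group n)"
    using C.cross_number_le_little_cross[OF R] by blast
  moreover have "cross_number (integer_mod_group n) ?R = real (n - 1) / real n"
    unfolding C.cross_number_eq[OF R] by (simp add: ord1)
  moreover have "real (n - 1) / real n = 1 - 1 / real n" using n by (simp add: of_nat_diff diff_divide_distrib)
  ultimately show ?thesis using upper n_def by simp
qed

lemma group_exp_pos:
  assumes "fin_comm_group G" shows "group_exp G > 0"
proof -
  interpret fin_comm_group G by fact
  have "0 \<notin> ord ` carrier G" using ord_pos by force
  then have "Lcm (ord ` carrier G) \<noteq> 0" using fin by (simp add: Lcm_0_iff)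
  then show ?thesis unfolding group_exp_def by simp
qed

lemma little_cross_rank2_le:
  assumes "fin_comm_group G" and p: "Factorial_Ring.prime p" and prec: "prec2 p (group_exp G)"
  shows "little_cross ((integer_mod_group (p ^ m) \<times>\<times> integer_mod_group (p ^ n)) \<times>\<times> G)
     \<le> (1 - 1 / real (p ^ m)) + (1 - 1 / real (p ^ n)) + little_cross G"
proof -
  let ?H = "integer_mod_group (p ^ m) \<times>\<times> integer_mod_group (p ^ n)"
  have p0: "p > 0" using p prime_gt_0_nat by blast
  have Cm: "fin_comm_group (integer_mod_group (p ^ m))" and Cn: "fin_comm_group (integer_mod_group (p ^ n))"
    using p0 by (auto intro: fin_comm_group_integer_mod_group)
  interpret G: fin_comm_group G by fact
  interpret H: fin_comm_group ?H by (rule fin_comm_group_DirProd[OF Cm Cn])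
  have dvd_exp: "G.ord g dvd group_exp G" if "g \<in> carrier G" for g
    unfolding group_exp_def using that by (intro dvd_Lcm) auto
  obtain f where f: "olson_fun p ?H (1 - 1 / real (p ^ m) + (1 - 1 / real (p ^ n))) f"
    using olson_fun_DirProd[OF Cm Cn olson_fun_cyclic[OF p] olson_fun_cyclic[OF p]] by blast
  interpret cross_setting ?H G p "1 - 1 / real (p ^ m) + (1 - 1 / real (p ^ n))" f
  proof unfold_locales
    fix x assume x: "x \<in> carrier ?H"
    have "x [^]\<^bsub>?H\<^esub> (p ^ (m + n)) = \<one>\<^bsub>?H\<^esub>"
      by (cases x) (simp add: DirProd_nat_pow power_add)
    then have "H.ord x dvd p ^ (m + n)" using H.pow_eq_id[OF x] by blast
    then show "\<exists>i. H.ord x = p ^ i" using divides_primepow_nat[OF p] by auto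
  next
    fix g assume "g \<in> carrier G"
    then show "\<not> p dvd G.ord g" using dvd_exp prec by (meson dvd_trans prec2_def)
  next
    fix i :: nat and S
    assume "i \<ge> 1" "set_mset S \<subseteq> carrier ?H" "\<And>x. x \<in># S \<Longrightarrow> x [^]\<^bsub>?H\<^esub> (p ^ i) = \<one>\<^bsub>?H\<^esub>" "size S \<ge> 3 * p - 2"
    then show "\<exists>T. T \<subseteq># S \<and> T \<noteq> {#} \<and> size T \<le> p \<and> seq_sum ?H T [^]\<^bsub>?H\<^esub> (p ^ (i - 1)) = \<one>\<^bsub>?H\<^esub>"
      using rank2_short_order_drop[OF p, of i S m n] by metis
  next
    let ?e = "group_exp G"
    have fin: "finite {d. d dvd ?e}" using group_exp_pos[OF assms(1)] by simp
    \<comment> \<open>Orders of nontrivial elements are divisors of the exponent other than 1.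
      Removing the divisor 1 turns (2p + 2)/(2p + 1) into 1/(2p + 1).\<close>
    have "(\<Sum>d\<in>G.ord ` (carrier G - {\<one>\<^bsub>G\<^esub>}). 1 / real d) \<le> (\<Sum>d\<in>{d. d dvd ?e} - {1}. 1 / real d)"
    proof (rule sum_mono2)
      show "G.ord ` (carrier G - {\<one>\<^bsub>G\<^esub>}) \<subseteq> {d. d dvd ?e} - {1}"
        using dvd_exp G.ord_eq_1 by auto
    qed (use fin in auto)
    also have "\<dots> = (\<Sum>d | d dvd ?e. 1 / real d) - 1" using fin by (subst sum_diff1) auto
    also have "\<dots> \<le> (2 * real p + 2) / (2 * real p + 1) - 1" using prec by (simp add: prec2_def)
    also have "\<dots> = 1 / (2 * real p + 1)" by (simp add: field_simps)
    finally show "(\<Sum>d\<in>G.ord ` (carrier G - {\<one>\<^bsub>G\<^esub>}). 1 / real d) \<le> 1 / (2 * real p + 1)" .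
  qed (use p f in auto)
  show ?thesis using little_cross_DirProd_le by simp
qed

theorem theorem7:
  fixes G :: "('a, 'b) monoid_scheme" and p m n :: nat
  assumes "comm_group G" and "finite (carrier G)"
    and "Factorial_Ring.prime p" and "prec2 p (group_exp G)"
    and "m > 0" and "n > 0"
  shows "little_cross (integer_mod_group (p ^ m) \<times>\<times> integer_mod_group (p ^ n) \<times>\<times> G)
      = little_cross (integer_mod_group (p ^ m)) + little_cross (integer_mod_group (p ^ n))
        + little_cross G
    \<and> (little_cross G = k_star G \<longrightarrow>
        little_cross (integer_mod_group (p ^ m) \<times>\<times> integer_mod_group (p ^ n) \<times>\<times> G)
        = k_star (integer_mod_group (p ^ m) \<times>\<times> integer_mod_group (p ^ n) \<times>\<times> G))"
proof -
  let ?A = "integer_mod_group (p ^ m)" and ?B = "integer_mod_group (p ^ n)"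
  have G: "fin_comm_group G" using assms(1,2) by (simp add: fin_comm_group_def fin_comm_group_axioms_def)
  have gG: "group G" using assms(1) by (simp add: comm_group_def)
  have p0: "p > 0" using assms(3) prime_gt_0_nat by blast
  have A: "fin_comm_group ?A" and B: "fin_comm_group ?B"
    using p0 by (auto intro: fin_comm_group_integer_mod_group)
  note BG = fin_comm_group_DirProd[OF B G]
  have kA: "little_cross ?A = 1 - 1 / real (p ^ m)" and kB: "little_cross ?B = 1 - 1 / real (p ^ n)"
    using little_cross_cyclic assms(3,5,6) by blast+
  \<comment> \<open>The upper bound treats the two p-parts as one factor \<open>H\<close>;
    reassociation is an injective homomorphism.\<close>
  have "little_cross (?A \<times>\<times> ?B \<times>\<times> G) \<le> little_cross ((?A \<times>\<times> ?B) \<times>\<times> G)"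
    by (rule little_cross_mono[where h = "\<lambda>(x, y, z). ((x, y), z)"])
      (auto intro: fin_comm_group_DirProd A B G simp: hom_def inj_on_def)
  also have "\<dots> \<le> little_cross ?A + little_cross ?B + little_cross G"
    unfolding kA kB by (rule little_cross_rank2_le[OF G assms(3,4)])
  finally have "little_cross (?A \<times>\<times> ?B \<times>\<times> G) \<le> little_cross ?A + little_cross ?B + little_cross G" .
  moreover have "little_cross ?A + (little_cross ?B + little_cross G) \<le> little_cross (?A \<times>\<times> ?B \<times>\<times> G)"
    using little_cross_superadditive[OF A BG] little_cross_superadditive[OF B G] by simp
  ultimately have eq: "little_cross (?A \<times>\<times> ?B \<times>\<times> G) = little_cross ?A + little_cross ?B + little_cross G"
    by simp
  obtain r q a where dec: "prime_power_decomposition G r q a"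
    using prime_power_decomposition_exists[OF G] by blast
  have "k_star (?A \<times>\<times> ?B \<times>\<times> G) = (1 - 1 / real (p ^ m)) + k_star (?B \<times>\<times> G)"
    using prime_power_decomposition_cyclic_times[OF gG dec assms(3), of n] assms(3,5,6)
    by (intro k_star_cyclic_times) (auto intro: DirProd_group gG)
  also have "k_star (?B \<times>\<times> G) = (1 - 1 / real (p ^ n)) + k_star G"
    using assms(6) by (intro k_star_cyclic_times[OF gG dec assms(3)]) simp
  finally show ?thesis using eq kA kB by simp
qed

end
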